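(* The closure $\overline{\mathcal{N}_{6,2}}$ of $\mathcal{N}_{6,2}$ in $\mathcal{N}_6$ is homeomorphic to $S$ under the map $$\Psi\colon\overline{\mathcal{N}_{6,2}}\to S,\qquad j=(j_-,j_+)\mapsto\bigl(\operatorname{Spec}(j_-^*j_-),\operatorname{Spec}(j_+^*j_+),\operatorname{Tr}(j_+^*j_+j_-^*j_-)\bigr),$$ where $\operatorname{Spec}(j_\pm^*j_\pm)$ is recorded as the ordered pair $(\alpha_\pm,\beta_\pm)$ of eigenvalues (with multiplicity), $\alpha_\pm\le\beta_\pm$.
   Context: $\mathcal{N}_6=\widehat{\mathcal{N}}_6/\mathrm{O}(6)$ (quotient topology), where $\widehat{\mathcal{N}}_6=\{c\in\operatorname{Hom}(\Lambda^2\mathbb{R}^6,\mathbb{R}^6)\mid c(c(u,v),w)=0\ \forall u,v,w\}$ is the space of (at most) $2$-step nilpotent Lie brackets on Euclidean $\mathbb{R}^6$. $\mathcal{N}_{6,2}\subset\mathcal{N}_6$ is the set of classes of brackets with $2$-dimensional commutator ideal; equivalently, classes of surjective $c\in\operatorname{Hom}(\Lambda^2\mathbb{R}^4,\mathbb{R}^2)$ modulo $\mathrm{O}(4)\times\mathrm{O}(2)$, extended by $0$ to $\mathbb{R}^6=\mathbb{R}^4\oplus\mathbb{R}^2$. A bracket $c\in\operatorname{Hom}(\Lambda^2\mathbb{R}^4,\mathbb{R}^2)$ is encoded by $j=c^*\colon\mathbb{R}^2\to\Lambda^2\mathbb{R}^4\cong\mathfrak{so}(4)$, and points of $\overline{\mathcal{N}_{6,2}}$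 are represented by arbitrary linear maps $j\colon\mathbb{R}^2\to\mathfrak{so}(4)$ modulo $\mathrm{O}(2)\times\mathrm{O}(4)$. Use the splitting $\mathfrak{so}(4)=\mathbb{R}^3_+\oplus\mathbb{R}^3_-$ into the two ideals isomorphic to $\mathfrak{so}(3)$: identifying $\mathfrak{so}(4)$ with $\Lambda^2\mathbb{R}^4$ (write $e^{ij}=e^i\wedge e^j$ for the skew matrix with entry $1$ in position $(i,j)$ and $-1$ in position $(j,i)$), $\mathbb{R}^3_\pm$ has basis $e_1^\pm=e^{12}\pm e^{34}$, $e_2^\pm=e^{13}\mp e^{24}$, $e_3^\pm=e^{14}\pm e^{23}$. The scalar product on $\mathfrak{so}(4)$ is the invariant one making $(e_i^\pm)$ orthonormal. Elements of $\mathrm{SO}(4)$ act through $\mathrm{SO}(3)\times\mathrm{SO}(3)$ on $\mathbb{R}^3_+\oplus\mathbb{R}^3_-$, and elements of $\mathrm{O}(4)$ of determinant $-1$ interchange the two factors. Write $j_\pm\colon\mathbb{R}^2\to\mathbb{R}^3_\pm$ for the two components of $j$. The space $S$ is $$S=\left\{(\alpha_-,\beta_-,\alpha_+,\beta_+,t)\in\mathbb{R}^5\ \middle|\ 0\le\alpha_-\le\beta_-,\ 0\le\alpha_+\le\beta_+,\ t\in I_{\alpha_\pm,\beta_\pm}\right\}\Big/\sim,$$ with the quotient of the subspace topology, where $I_{\alpha_\pm,\beta_\pm}=[\alpha_-\beta_++\alpha_+\beta_-,\ \alpha_-\alpha_++\beta_-\beta_+]$ and $(\alpha_-,\beta_-,\alpha_+,\beta_+,t)\sim(\alpha_+,\beta_+,\alpha_-,\beta_-,t)$.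 *)

theory Defs
  imports "HOL-Analysis.Analysis"
begin

section \<open>Quotient spaces\<close>

definition quotient_topology :: "'a topology \<Rightarrow> ('a \<times> 'a) set \<Rightarrow> 'a set topology" where
  "quotient_topology X R =
     topology (\<lambda>U. U \<subseteq> topspace X // R \<and> openin X {x \<in> topspace X. R `` {x} \<in> U})"

lemma openin_quotient_topology:
  "openin (quotient_topology X R) U \<longleftrightarrow>
     U \<subseteq> topspace X // R \<and> openin X {x \<in> topspace X. R `` {x} \<in> U}"
proof -
  let ?P = "\<lambda>U. U \<subseteq> topspace X // R \<and> openin X {x \<in> topspace X. R `` {x} \<in> U}"
  have "istopology ?P"
    unfolding istopology_def
  proof (intro conjI allI impI)
    fix S T assume S: "?P S" and T: "?P T"
    have "{x \<in> topspace X. R `` {x} \<in> S \<inter> T} =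
          {x \<in> topspace X. R `` {x} \<in> S} \<inter> {x \<in> topspace X. R `` {x} \<in> T}" by auto
    then show "openin X {x \<in> topspace X. R `` {x} \<in> S \<inter> T}"
      using S T by auto
    show "S \<inter> T \<subseteq> topspace X // R" using S by auto
  next
    fix K assume K: "\<forall>S\<in>K. ?P S"
    have "{x \<in> topspace X. R `` {x} \<in> \<Union>K} =
          (\<Union>S\<in>K. {x \<in> topspace X. R `` {x} \<in> S})" by auto
    then show "openin X {x \<in> topspace X. R `` {x} \<in> \<Union>K}"
      using K by auto
    show "\<Union>K \<subseteq> topspace X // R" using K by blast
  qed
  then show ?thesis
    by (simp add: quotient_topology_def)
qed

lemma topspace_quotient_topology [simp]:
  "topspace (quotient_topology X R) = topspace X // R"
proof
  show "topspace (quotient_topology X R) \<subseteq> topspace X // R"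
    unfolding topspace_def[of "quotient_topology X R"] openin_quotient_topology by blast
  have "{x \<in> topspace X. R `` {x} \<in> topspace X // R} = topspace X"
    by (auto simp: quotient_def)
  then have "openin (quotient_topology X R) (topspace X // R)"
    by (simp add: openin_quotient_topology)
  then show "topspace X // R \<subseteq> topspace (quotient_topology X R)"
    by (rule openin_subset)
qed

lemma quotient_map_quotient_topology:
  "quotient_map X (quotient_topology X R) (\<lambda>x. R `` {x})"
  unfolding quotient_map_def topspace_quotient_topology openin_quotient_topology
  by (auto simp: quotient_def)


section \<open>The moduli space of 2-step nilpotent brackets on \<open>\<real>\<^sup>6\<close>\<close>

text \<open>Curried bilinear maps; all linear maps between finite-dimensional spaces are bounded, and
  the norm topology of this type is the usual topology of the finite-dimensional space
  of bilinear maps.\<close>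

type_synonym bilin6 = "(real^6) \<Rightarrow>\<^sub>L (real^6) \<Rightarrow>\<^sub>L (real^6)"

abbreviation br :: "bilin6 \<Rightarrow> real^6 \<Rightarrow> real^6 \<Rightarrow> real^6" where
  "br c u v \<equiv> blinfun_apply (blinfun_apply c u) v"

definition N6_hat :: "bilin6 set" where
  "N6_hat = {c. (\<forall>u. br c u u = 0) \<and> (\<forall>u v w. br c (br c u v) w = 0)}"

definition O6_rel :: "(bilin6 \<times> bilin6) set" where
  "O6_rel = {(c, c'). c \<in> N6_hat \<and> c' \<in> N6_hat \<and>
     (\<exists>Q :: real^6 \<Rightarrow> real^6. orthogonal_transformation Q \<and> (\<forall>u v. br c' (Q u) (Q v) = Q (br c u v)))}"

definition bracket_class :: "bilin6 \<Rightarrow> bilin6 set" where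
  "bracket_class c = O6_rel `` {c}"

definition N6 :: "bilin6 set topology" where
  "N6 = quotient_topology (top_of_set N6_hat) O6_rel"

definition commutator_ideal :: "bilin6 \<Rightarrow> (real^6) set" where
  "commutator_ideal c = span {br c u v | u v. True}"

definition N62 :: "bilin6 set set" where
  "N62 = {bracket_class c | c. c \<in> N6_hat \<and> dim (commutator_ideal c) = 2}"


section \<open>Linear maps \<open>j : \<real>\<^sup>2 \<rightarrow> so(4)\<close> and their brackets\<close>

definition so4 :: "(real^4^4) set" where
  "so4 = {M. transpose M = - M}"

definition Hom_R2_so4 :: "(real^2 \<Rightarrow> real^4^4) set" where
  "Hom_R2_so4 = {j. linear j \<and> range j \<subseteq> so4}"

text \<open>\<open>\<real>\<^sup>6 = \<real>\<^sup>4 \<oplus> \<real>\<^sup>2\<close>: coordinates 1 to 4 and coordinates 5, 6.\<close>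

definition proj4 :: "real^6 \<Rightarrow> real^4" where
  "proj4 u = vector [u $ 1, u $ 2, u $ 3, u $ 4]"

definition incl2 :: "real^2 \<Rightarrow> real^6" where
  "incl2 z = z $ 1 *\<^sub>R axis 5 1 + z $ 2 *\<^sub>R axis 6 1"

text \<open>The bracket \<open>c \<in> Hom(\<Lambda>\<^sup>2\<real>\<^sup>4, \<real>\<^sup>2)\<close> with \<open>c\<^sup>* = j\<close>, extended by 0 to \<open>\<real>\<^sup>6\<close>.
  The adjoint is taken with respect to the scalar product on \<open>\<Lambda>\<^sup>2\<real>\<^sup>4\<close> in which the \<open>e\<^sup>i\<^sup>j\<close>
  (\<open>i < j\<close>) are orthonormal, so it says that \<open>c(u,v) \<bullet> z = u \<bullet> j(z) v\<close>; see
  \<open>inner_bracket_of\<close> below.\<close>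

definition bracket_of :: "(real^2 \<Rightarrow> real^4^4) \<Rightarrow> bilin6" where
  "bracket_of j =
     Blinfun (\<lambda>u. Blinfun (\<lambda>v. incl2 (\<chi> k. proj4 u \<bullet> (j (axis k 1) *v proj4 v))))"

lemma proj4_nth [simp]:
  "proj4 u $ 1 = u $ 1" "proj4 u $ 2 = u $ 2" "proj4 u $ 3 = u $ 3" "proj4 u $ 4 = u $ 4"
  by (simp_all add: proj4_def vector_def)

lemma linear_proj4: "linear proj4"
  by (rule linearI) (simp_all add: vec_eq_iff forall_4)

lemma linear_incl2: "linear incl2"
  by (rule linearI) (simp_all add: incl2_def algebra_simps)

lemma bracket_of_apply:
  "br (bracket_of j) u v = incl2 (\<chi> k. proj4 u \<bullet> (j (axis k 1) *v proj4 v))"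
proof -
  let ?f = "\<lambda>u v. incl2 (\<chi> k. proj4 u \<bullet> (j (axis k 1) *v proj4 v))"
  note lp = linear_add[OF linear_proj4] linear_cmul[OF linear_proj4]
  note li = linear_add[OF linear_incl2, symmetric] linear_cmul[OF linear_incl2, symmetric]
  have lv: "linear (?f u)" for u
    by (rule linearI; unfold li lp, rule arg_cong[of _ _ incl2])
      (simp_all add: vec_eq_iff matrix_vector_right_distrib matrix_vector_mult_scaleR inner_right_distrib)
  then have bv: "bounded_linear (?f u)" for u
    by (simp add: linear_conv_bounded_linear)
  have ap: "blinfun_apply (Blinfun (?f u)) = ?f u" for u
    by (rule bounded_linear_Blinfun_apply[OF bv])
  have "linear (\<lambda>u. Blinfun (?f u))"
  proof (rule linearI)
    fix a b
    have "?f (a + b) v = ?f a v + ?f b v" for v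
      unfolding li lp by (rule arg_cong[of _ _ incl2]) (simp add: vec_eq_iff inner_left_distrib)
    then have "blinfun_apply (Blinfun (?f (a + b))) v =
        blinfun_apply (Blinfun (?f a) + Blinfun (?f b)) v" for v
      unfolding blinfun.add_left ap .
    then show "Blinfun (?f (a + b)) = Blinfun (?f a) + Blinfun (?f b)"
      by (rule blinfun_eqI)
  next
    fix r b
    have "?f (r *\<^sub>R b) v = r *\<^sub>R ?f b v" for v
      unfolding li lp by (rule arg_cong[of _ _ incl2]) (simp add: vec_eq_iff)
    then have "blinfun_apply (Blinfun (?f (r *\<^sub>R b))) v =
        blinfun_apply (r *\<^sub>R Blinfun (?f b)) v" for v
      unfolding blinfun.scaleR_left ap .
    then show "Blinfun (?f (r *\<^sub>R b)) = r *\<^sub>R Blinfun (?f b)"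
      by (rule blinfun_eqI)
  qed
  then have bl: "bounded_linear (\<lambda>u. Blinfun (?f u))"
    by (simp add: linear_conv_bounded_linear)
  show ?thesis
    unfolding bracket_of_def bounded_linear_Blinfun_apply[OF bl] ap ..
qed

lemma inner_bracket_of:
  assumes "j \<in> Hom_R2_so4"
  shows "br (bracket_of j) u v \<bullet> incl2 z = proj4 u \<bullet> (j z *v proj4 v)"
proof -
  have lin: "linear j" using assms by (simp add: Hom_R2_so4_def)
  have "z = z $ 1 *\<^sub>R axis 1 1 + z $ 2 *\<^sub>R axis 2 1"
    by (simp add: vec_eq_iff forall_2 axis_def)
  then have "j z = z $ 1 *\<^sub>R j (axis 1 1) + z $ 2 *\<^sub>R j (axis 2 1)"
    using linear_add[OF lin] linear_cmul[OF lin] by metis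
  then have "proj4 u \<bullet> (j z *v proj4 v) =
      z $ 1 * (proj4 u \<bullet> (j (axis 1 1) *v proj4 v)) + z $ 2 * (proj4 u \<bullet> (j (axis 2 1) *v proj4 v))"
    by (simp add: matrix_vector_mult_add_rdistrib scaleR_matrix_vector_assoc[symmetric]
        inner_right_distrib)
  then show ?thesis
    by (simp add: bracket_of_apply incl2_def inner_left_distrib inner_right_distrib
        inner_axis_axis)
qed


section \<open>The splitting of \<open>so(4)\<close>\<close>

definition skew_unit :: "4 \<Rightarrow> 4 \<Rightarrow> real^4^4" where
  "skew_unit i j = (\<chi> a b. if a = i \<and> b = j then 1 else if a = j \<and> b = i then - 1 else 0)"

text \<open>The basis \<open>e\<^sub>1\<^sup>\<plusminus>, e\<^sub>2\<^sup>\<plusminus>, e\<^sub>3\<^sup>\<plusminus>\<close> of \<open>\<real>\<^sup>3\<^sub>\<plusminus>\<close>, for the sign \<open>s = 1\<close> or \<open>s = -1\<close>.\<close>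

definition e_basis :: "real \<Rightarrow> real^4^4^3" where
  "e_basis s = vector [skew_unit 1 2 + s *\<^sub>R skew_unit 3 4,
                       skew_unit 1 3 - s *\<^sub>R skew_unit 2 4,
                       skew_unit 1 4 + s *\<^sub>R skew_unit 2 3]"

text \<open>The invariant scalar product normalised so that the basis of \<open>so(4)\<close> is orthonormal.\<close>

definition so4_inner :: "real^4^4 \<Rightarrow> real^4^4 \<Rightarrow> real" where
  "so4_inner A B = - trace (A ** B) / 4"

lemma so4_inner_e_basis:
  assumes "s \<in> {1, - 1}" "t \<in> {1, - 1}"
  shows "so4_inner (e_basis s $ i) (e_basis t $ k) = (if s = t \<and> i = k then 1 else 0)"
proof -
  have "\<forall>i k. so4_inner (e_basis s $ i) (e_basis t $ k) = (if s = t \<and> i = k then 1 else 0)"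
    using assms
    by (auto simp: forall_3 so4_inner_def e_basis_def trace_def matrix_matrix_mult_def
        skew_unit_def sum_4)
  then show ?thesis by blast
qed

lemma so4_splitting:
  assumes "M \<in> so4"
  shows "M = (\<Sum>i\<in>UNIV. so4_inner M (e_basis (- 1) $ i) *\<^sub>R e_basis (- 1) $ i) +
             (\<Sum>i\<in>UNIV. so4_inner M (e_basis 1 $ i) *\<^sub>R e_basis 1 $ i)"
proof -
  have sk: "M $ b $ a = - (M $ a $ b)" for a b
  proof -
    have "transpose M $ a $ b = (- M) $ a $ b"
      using assms by (simp only: so4_def mem_Collect_eq)
    then show ?thesis by (simp only: transpose_def vec_lambda_beta vector_uminus_component)
  qed
  have diag: "M $ a $ a = 0" for a
    using sk[of a a] by simp
  note sks = sk[of 2 1] sk[of 3 1] sk[of 4 1] sk[of 3 2] sk[of 4 2] sk[of 4 3]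
  have "so4_inner M (e_basis s $ 1) = (M $ 1 $ 2 + s * M $ 3 $ 4) / 2"
    and "so4_inner M (e_basis s $ 2) = (M $ 1 $ 3 - s * M $ 2 $ 4) / 2"
    and "so4_inner M (e_basis s $ 3) = (M $ 1 $ 4 + s * M $ 2 $ 3) / 2" for s
    by (simp_all add: so4_inner_def e_basis_def trace_def matrix_matrix_mult_def
        skew_unit_def sum_4 sks)
  note coords = this
  show ?thesis
    unfolding sum_3 coords vec_eq_iff forall_4
    by (simp add: e_basis_def skew_unit_def sks diag field_simps)
qed

text \<open>\<open>j\<^sub>-\<close> and \<open>j\<^sub>+\<close>, in coordinates with respect to the orthonormal bases of \<open>\<real>\<^sup>3\<^sub>-\<close> and \<open>\<real>\<^sup>3\<^sub>+\<close>.\<close>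

definition j_minus :: "(real^2 \<Rightarrow> real^4^4) \<Rightarrow> real^2 \<Rightarrow> real^3" where
  "j_minus j z = (\<chi> i. so4_inner (j z) (e_basis (- 1) $ i))"

definition j_plus :: "(real^2 \<Rightarrow> real^4^4) \<Rightarrow> real^2 \<Rightarrow> real^3" where
  "j_plus j z = (\<chi> i. so4_inner (j z) (e_basis 1 $ i))"


section \<open>The space \<open>S\<close>\<close>

type_synonym real5 = "real \<times> real \<times> real \<times> real \<times> real"

definition S_hat :: "real5 set" where
  "S_hat = {(am, bm, ap, bp, t). 0 \<le> am \<and> am \<le> bm \<and> 0 \<le> ap \<and> ap \<le> bp \<and>
      t \<in> {am * bp + ap * bm .. am * ap + bm * bp}}"

fun swap_pm :: "real5 \<Rightarrow> real5" where
  "swap_pm (am, bm, ap, bp, t) = (ap, bp, am, bm, t)"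

definition S_rel :: "(real5 \<times> real5) set" where
  "S_rel = {(p, q). p \<in> S_hat \<and> q \<in> S_hat \<and> (q = p \<or> q = swap_pm p)}"

definition S_class :: "real5 \<Rightarrow> real5 set" where
  "S_class p = S_rel `` {p}"

definition S_space :: "real5 set topology" where
  "S_space = quotient_topology (top_of_set S_hat) S_rel"


section \<open>The map \<open>\<Psi>\<close>\<close>

text \<open>The ordered pair of eigenvalues, counted with multiplicity as roots of the characteristic
  polynomial; meaningful for maps with real spectrum.\<close>

definition Spec :: "(real^2 \<Rightarrow> real^2) \<Rightarrow> real \<times> real" where
  "Spec f = (THE (a, b). a \<le> b \<and> (\<forall>x. det (mat x - matrix f) = (x - a) * (x - b)))"

lemma Spec_eqI:
  assumes "a \<le> b" and ab: "\<And>x. det (mat x - matrix f) = (x - a) * (x - b)"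
  shows "Spec f = (a, b)"
  unfolding Spec_def
proof (rule the_equality)
  show "case (a, b) of (a, b) \<Rightarrow> a \<le> b \<and> (\<forall>x. det (mat x - matrix f) = (x - a) * (x - b))"
    using assms by simp
next
  fix p assume p: "case p of (a, b) \<Rightarrow> a \<le> b \<and> (\<forall>x. det (mat x - matrix f) = (x - a) * (x - b))"
  obtain c d where pd: "p = (c, d)" by (cases p)
  have le: "c \<le> d" and eq: "(x - a) * (x - b) = (x - c) * (x - d)" for x
    using p ab by (auto simp: pd)
  have s: "a + b = c + d" using eq[of 0] eq[of 1] by (simp add: algebra_simps)
  have "(c - a) * (c - b) = 0" using eq[of c] by simp
  then have "c = a \<or> c = b" by simp
  then have "c = a \<and> d = b" using s le \<open>a \<le> b\<close> by auto
  then show "p = (a, b)" by (simp add: pd)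
qed

definition invariants :: "(real^2 \<Rightarrow> real^4^4) \<Rightarrow> real5" where
  "invariants j =
     (let A = adjoint (j_minus j) \<circ> j_minus j;
          B = adjoint (j_plus j) \<circ> j_plus j;
          (am, bm) = Spec A;
          (ap, bp) = Spec B
      in (am, bm, ap, bp, trace (matrix (B \<circ> A))))"

text \<open>The value at a class is computed from any \<open>j\<close> representing it. That this does not depend
  on \<open>j\<close>, and that every point of the closure has such a representative, is part of the
  theorem.\<close>

definition Psi :: "bilin6 set \<Rightarrow> real5 set" where
  "Psi x = the_elem {S_class (invariants j) | j. j \<in> Hom_R2_so4 \<and> bracket_class (bracket_of j) = x}"

end

theory Submission
  imports Defs
begin

text \<open>
  A pair \<open>(j\<^sub>-, j\<^sub>+)\<close> is given by the images \<open>x, y\<close> and \<open>p, q\<close> in \<open>\<real>\<^sup>3\<close> of the standard basis of \<open>\<real>\<^sup>2\<close>.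
  Unit quaternions in \<open>SO(4)\<close> rotate the two copies of \<open>\<real>\<^sup>3\<close> independently, so a class only depends
  on the two Gram matrices \<open>A, B\<close>, modulo the swap and simultaneous conjugation by \<open>O(2)\<close>. Writing
  \<open>A\<close> and \<open>B\<close> as scalar plus traceless parts, the latter is the classification of pairs of plane
  vectors by norms and inner product, which gives injectivity and the image of \<open>\<Psi>\<close>.

  Conversely, let \<open>J(z)\<close> be the skew endomorphism of \<open>\<real>\<^sup>6\<close> dual to the bracket. The traces of
  \<open>J(z)\<^sup>2\<close> and \<open>J(z)\<^sup>4\<close> determine \<open>A + B\<close> and the product of the quadratic forms \<open>A\<close> and \<open>B\<close>, hence
  the unordered pair of forms. This works for every isometry of \<open>\<real>\<^sup>6\<close>, also when \<open>j\<close> is degenerate and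
  the isometry does not respect \<open>\<real>\<^sup>4 \<oplus> \<real>\<^sup>2\<close>.

  For the topology, the maps from the parameter space \<open>(\<real>\<^sup>3)\<^sup>4\<close> to both quotients are continuous and
  closed (\<open>O(6)\<close> is compact, and the trace bounds the parameters), hence quotient maps.
\<close>

section \<open>Brackets and isometries\<close>

lemma exhaust_6:
  fixes x :: 6
  shows "x = 1 \<or> x = 2 \<or> x = 3 \<or> x = 4 \<or> x = 5 \<or> x = 6"
proof (induct x)
  case (of_int z)
  \<comment> \<open>Induction yields representatives from 0 to 5; the numeral \<open>6\<close> is
    \<open>0\<close> in this type.\<close>
  then have "z = 0 \<or> z = 1 \<or> z = 2 \<or> z = 3 \<or> z = 4 \<or> z = 5" by fastforce
  then show ?case by auto
qed

lemma forall_6: "(\<forall>i::6. P i) \<longleftrightarrow> P 1 \<and> P 2 \<and> P 3 \<and> P 4 \<and> P 5 \<and> P 6"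
  by (metis exhaust_6)

lemma UNIV_6: "UNIV = {1::6, 2, 3, 4, 5, 6}"
  using exhaust_6 by auto

lemma sum_6: "sum f (UNIV::6 set) = f 1 + f 2 + f 3 + f 4 + f 5 + f 6"
  unfolding UNIV_6 by (simp add: ac_simps)

section \<open>Coordinates for the splitting of R^6 into R^4 and R^2\<close>

definition proj2 :: "real^6 \<Rightarrow> real^2" where
  "proj2 u = vector [u $ 5, u $ 6]"

definition incl4 :: "real^4 \<Rightarrow> real^6" where
  "incl4 w = w $ 1 *\<^sub>R axis 1 1 + w $ 2 *\<^sub>R axis 2 1 + w $ 3 *\<^sub>R axis 3 1 + w $ 4 *\<^sub>R axis 4 1"

lemma proj2_nth [simp]: "proj2 u $ 1 = u $ 5" "proj2 u $ 2 = u $ 6"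
  by (simp_all add: proj2_def vector_def)

lemma incl4_nth [simp]:
  "incl4 w $ 1 = w $ 1" "incl4 w $ 2 = w $ 2" "incl4 w $ 3 = w $ 3" "incl4 w $ 4 = w $ 4"
  "incl4 w $ 5 = 0" "incl4 w $ 6 = 0"
  by (simp_all add: incl4_def axis_def)

lemma incl2_nth [simp]:
  "incl2 w $ 1 = 0" "incl2 w $ 2 = 0" "incl2 w $ 3 = 0" "incl2 w $ 4 = 0"
  "incl2 w $ 5 = w $ 1" "incl2 w $ 6 = w $ 2"
  by (simp_all add: incl2_def axis_def)

lemma proj_incl [simp]:
  "proj4 (incl4 a) = a" "proj4 (incl2 b) = 0" "proj2 (incl4 a) = 0" "proj2 (incl2 b) = b"
  "proj4 (u + v) = proj4 u + proj4 v" "proj2 (u + v) = proj2 u + proj2 v"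
  by (simp_all add: vec_eq_iff forall_4 forall_2)

lemma inner_6: "(u::real^6) \<bullet> v = proj4 u \<bullet> proj4 v + proj2 u \<bullet> proj2 v"
  by (simp add: inner_vec_def sum_6 sum_4 sum_2)

lemma so4_entry: "M \<in> so4 \<longleftrightarrow> (\<forall>a b. M $ b $ a = - (M $ a $ b))"
  unfolding so4_def by (auto simp: vec_eq_iff transpose_def)

lemma skew_inner_self:
  assumes "M \<in> so4" shows "u \<bullet> (M *v u) = 0"
proof -
  have "u \<bullet> (M *v u) = (transpose M *v u) \<bullet> u"
    by (simp add: dot_lmul_matrix)
  also have "\<dots> = - (u \<bullet> (M *v u))"
    using assms scaleR_matrix_vector_assoc[of "- 1" M u, symmetric] by (simp add: so4_def inner_commute)
  finally show ?thesis by simp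
qed

text \<open>All values of the bracket lie in coordinates 5 and 6, which \<open>proj4\<close> kills;
  hence double brackets vanish.\<close>

lemma bracket_of_in_N6_hat:
  assumes "j \<in> Hom_R2_so4" shows "bracket_of j \<in> N6_hat"
proof -
  have "j z \<in> so4" for z using assms by (auto simp: Hom_R2_so4_def)
  then have "br (bracket_of j) u u = 0" for u
    by (simp add: bracket_of_apply vec_eq_iff forall_6 skew_inner_self)
  then show ?thesis
    by (simp add: N6_hat_def bracket_of_apply vec_eq_iff forall_6)
qed

section \<open>Isometry classes of brackets\<close>

lemma O6_rel_equiv: "equiv N6_hat O6_rel"
proof (rule equivI)
  show "O6_rel \<subseteq> N6_hat \<times> N6_hat" by (auto simp: O6_rel_def)
  show "refl_on N6_hat O6_rel"
  proof (rule refl_onI)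
    fix c assume "c \<in> N6_hat"
    then show "(c, c) \<in> O6_rel"
      unfolding O6_rel_def
      by (simp add: exI[where x = "\<lambda>x. x"] orthogonal_transformation_id)
  qed
  show "sym O6_rel"
  proof (rule symI)
    fix c c' assume "(c, c') \<in> O6_rel"
    then obtain Q where c: "c \<in> N6_hat" "c' \<in> N6_hat" and Q: "orthogonal_transformation Q"
      and eq: "\<And>u v. br c' (Q u) (Q v) = Q (br c u v)"
      by (auto simp: O6_rel_def)
    have inv: "Q (inv Q a) = a" "inv Q (Q a) = a" for a
      using orthogonal_transformation_surj[OF Q] orthogonal_transformation_inj[OF Q]
      by (simp_all add: surj_f_inv_f)
    have "br c (inv Q u) (inv Q v) = inv Q (br c' u v)" for u v
      using arg_cong[OF eq[of "inv Q u" "inv Q v"], of "inv Q"] by (simp add: inv)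
    then show "(c', c) \<in> O6_rel"
      unfolding O6_rel_def using c orthogonal_transformation_inv[OF Q] by blast
  qed
  show "trans O6_rel"
  proof (rule transI)
    fix c c' c'' assume "(c, c') \<in> O6_rel" "(c', c'') \<in> O6_rel"
    then obtain Q Q' where c: "c \<in> N6_hat" "c'' \<in> N6_hat" and Q: "orthogonal_transformation Q"
        "orthogonal_transformation Q'"
      and eq: "\<And>u v. br c' (Q u) (Q v) = Q (br c u v)" "\<And>u v. br c'' (Q' u) (Q' v) = Q' (br c' u v)"
      by (auto simp: O6_rel_def)
    have "br c'' ((Q' \<circ> Q) u) ((Q' \<circ> Q) v) = (Q' \<circ> Q) (br c u v)" for u v
      by (simp add: eq)
    then show "(c, c'') \<in> O6_rel"
      unfolding O6_rel_def using c orthogonal_transformation_compose[OF Q(2,1)] by blast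
  qed
qed

lemma bracket_class_eq_iff:
  assumes "c \<in> N6_hat" "c' \<in> N6_hat"
  shows "bracket_class c = bracket_class c' \<longleftrightarrow> (c, c') \<in> O6_rel"
  unfolding bracket_class_def using eq_equiv_class_iff[OF O6_rel_equiv assms] .

lemma orthogonal_matrix_inner:
  "orthogonal_matrix g \<Longrightarrow> (g *v a) \<bullet> (g *v b) = a \<bullet> b" for g :: "real^'n^'n"
  using orthogonal_transformation_matrix[of "(*v) g"]
  by (simp add: orthogonal_transformation_def matrix_vector_mul_linear)

text \<open>The isometry of R^6 is the block map with \<open>g\<close> on R^4 and \<open>h\<close>
  on R^2. By \<open>inner_bracket_of\<close>, the two sides of the intertwining relation have equal
  inner products with all vectors \<open>h *v z\<close>.\<close>

lemma bracket_class_conj: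
  fixes g :: "real^4^4" and h :: "real^2^2"
  assumes j: "j \<in> Hom_R2_so4" "j' \<in> Hom_R2_so4"
    and g: "orthogonal_matrix g" and h: "orthogonal_matrix h"
    and eq: "\<And>z. j' (h *v z) = g ** j z ** transpose g"
  shows "bracket_class (bracket_of j) = bracket_class (bracket_of j')"
proof -
  define Q where "Q u = incl4 (g *v proj4 u) + incl2 (h *v proj2 u)" for u
  have lin: "linear Q"
    by (rule linearI) (simp_all add: Q_def vec_eq_iff forall_6 matrix_vector_right_distrib
        linear_cmul[OF linear_proj4] matrix_vector_mult_def sum_4 sum_2 algebra_simps)
  have proj: "proj4 (Q u) = g *v proj4 u" "proj2 (Q u) = h *v proj2 u" for u
    by (simp_all add: Q_def)
  have Q: "orthogonal_transformation Q"
    using lin by (simp add: orthogonal_transformation_def inner_6 proj orthogonal_matrix_inner g h)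
  have "br (bracket_of j') (Q u) (Q v) = Q (br (bracket_of j) u v)" for u v
  proof -
    define W W' where "W = proj2 (br (bracket_of j) u v)"
      and "W' = proj2 (br (bracket_of j') (Q u) (Q v))"
    have W: "br (bracket_of j) u v = incl2 W" "br (bracket_of j') (Q u) (Q v) = incl2 W'"
      by (simp_all add: W_def W'_def bracket_of_apply)
    have ii: "incl2 a \<bullet> incl2 b = a \<bullet> b" for a b by (simp add: inner_6)
    have gg: "transpose g *v (g *v a) = a" for a
      using g by (simp add: orthogonal_matrix matrix_vector_mul_assoc)
    have "W' \<bullet> (h *v z) = (h *v W) \<bullet> (h *v z)" for z
    proof -
      have "W' \<bullet> (h *v z) = (g *v proj4 u) \<bullet> (j' (h *v z) *v (g *v proj4 v))"
        using inner_bracket_of[OF j(2), of "Q u" "Q v" "h *v z"] by (simp add: W ii proj)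
      also have "j' (h *v z) *v (g *v proj4 v) = g *v (j z *v proj4 v)"
        using gg by (simp add: eq matrix_vector_mul_assoc[symmetric])
      also have "(g *v proj4 u) \<bullet> \<dots> = proj4 u \<bullet> (j z *v proj4 v)"
        by (rule orthogonal_matrix_inner[OF g])
      also have "\<dots> = W \<bullet> z"
        using inner_bracket_of[OF j(1), of u v z] by (simp add: W ii)
      finally show ?thesis by (simp add: orthogonal_matrix_inner[OF h])
    qed
    \<comment> \<open>Choosing z as the image of y under the transpose of \<open>h\<close> reaches
      every y, because \<open>h\<close> is orthogonal.\<close>
    then have "W' \<bullet> (h *v (transpose h *v y)) = (h *v W) \<bullet> (h *v (transpose h *v y))" for y by blast
    then have "W' \<bullet> y = (h *v W) \<bullet> y" for y
      using h by (simp add: orthogonal_matrix_def matrix_vector_mul_assoc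
          del: transpose_matrix_vector)
    then have "W' = h *v W" by (metis vector_eq_rdot)
    then show ?thesis unfolding W by (simp add: Q_def vec_eq_iff forall_6)
  qed
  then show ?thesis
    using Q j by (subst bracket_class_eq_iff) (auto simp: O6_rel_def bracket_of_in_N6_hat)
qed

section \<open>Conjugation on the two ideals\<close>

definition so4_of :: "real^3 \<Rightarrow> real^3 \<Rightarrow> real^4^4" where
  "so4_of a b = (\<Sum>i\<in>UNIV. a $ i *\<^sub>R e_basis (- 1) $ i) + (\<Sum>i\<in>UNIV. b $ i *\<^sub>R e_basis 1 $ i)"

definition jmap :: "real^3 \<Rightarrow> real^3 \<Rightarrow> real^3 \<Rightarrow> real^3 \<Rightarrow> real^2 \<Rightarrow> real^4^4" where
  "jmap x y p q z = so4_of (z $ 1 *\<^sub>R x + z $ 2 *\<^sub>R y) (z $ 1 *\<^sub>R p + z $ 2 *\<^sub>R q)"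

lemma so4_of_nth [simp]:
  "so4_of a b $ 1 $ 1 = 0" "so4_of a b $ 2 $ 2 = 0" "so4_of a b $ 3 $ 3 = 0" "so4_of a b $ 4 $ 4 = 0"
  "so4_of a b $ 1 $ 2 = a $ 1 + b $ 1" "so4_of a b $ 2 $ 1 = - (a $ 1 + b $ 1)"
  "so4_of a b $ 1 $ 3 = a $ 2 + b $ 2" "so4_of a b $ 3 $ 1 = - (a $ 2 + b $ 2)"
  "so4_of a b $ 1 $ 4 = a $ 3 + b $ 3" "so4_of a b $ 4 $ 1 = - (a $ 3 + b $ 3)"
  "so4_of a b $ 2 $ 3 = b $ 3 - a $ 3" "so4_of a b $ 3 $ 2 = a $ 3 - b $ 3"
  "so4_of a b $ 2 $ 4 = a $ 2 - b $ 2" "so4_of a b $ 4 $ 2 = b $ 2 - a $ 2"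
  "so4_of a b $ 3 $ 4 = b $ 1 - a $ 1" "so4_of a b $ 4 $ 3 = a $ 1 - b $ 1"
  by (simp_all add: so4_of_def e_basis_def skew_unit_def sum_3)

lemma so4_of_in_so4: "so4_of a b \<in> so4"
  by (simp add: so4_entry forall_4)

lemma so4_eq_so4_of:
  "M \<in> so4 \<Longrightarrow> M = so4_of (\<chi> i. so4_inner M (e_basis (- 1) $ i)) (\<chi> i. so4_inner M (e_basis 1 $ i))"
  unfolding so4_of_def vec_lambda_beta by (rule so4_splitting)

lemma so4_inner_so4_of:
  "(\<chi> i. so4_inner (so4_of a b) (e_basis (- 1) $ i)) = a"
  "(\<chi> i. so4_inner (so4_of a b) (e_basis 1 $ i)) = b"
  by (simp_all add: vec_eq_iff forall_3 so4_inner_def trace_def matrix_matrix_mult_def sum_4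
      e_basis_def skew_unit_def)

lemma jmap_in_Hom: "jmap x y p q \<in> Hom_R2_so4"
  by (auto simp: Hom_R2_so4_def jmap_def so4_of_in_so4 vec_eq_iff forall_4 algebra_simps
      intro!: linearI)

lemma j_minus_jmap: "j_minus (jmap x y p q) z = z $ 1 *\<^sub>R x + z $ 2 *\<^sub>R y"
  and j_plus_jmap: "j_plus (jmap x y p q) z = z $ 1 *\<^sub>R p + z $ 2 *\<^sub>R q"
  unfolding j_minus_def j_plus_def jmap_def by (fact so4_inner_so4_of)+

lemma Hom_R2_so4_jmapE:
  assumes "j \<in> Hom_R2_so4"
  obtains x y p q where "j = jmap x y p q"
proof -
  have lin: "linear j" and so: "j z \<in> so4" for z using assms by (auto simp: Hom_R2_so4_def)
  obtain x p y q where e: "j (axis 1 1) = so4_of x p" "j (axis 2 1) = so4_of y q"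
    using so4_eq_so4_of[OF so] by metis
  have "j z = jmap x y p q z" for z
  proof -
    have "z = z $ 1 *\<^sub>R axis 1 1 + z $ 2 *\<^sub>R axis 2 1"
      by (simp add: vec_eq_iff forall_2 axis_def)
    then have "j z = z $ 1 *\<^sub>R j (axis 1 1) + z $ 2 *\<^sub>R j (axis 2 1)"
      using linear_add[OF lin] linear_cmul[OF lin] by metis
    then show ?thesis
      by (simp add: e jmap_def vec_eq_iff forall_4 algebra_simps)
  qed
  then show thesis using that by blast
qed

section \<open>Symmetries of the class as a function of four vectors\<close>

definition jclass :: "real^3 \<Rightarrow> real^3 \<Rightarrow> real^3 \<Rightarrow> real^3 \<Rightarrow> bilin6 set" where
  "jclass x y p q = bracket_class (bracket_of (jmap x y p q))"

lemma jclass_conj: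
  assumes "orthogonal_matrix g"
    and "\<And>a b. so4_of (f a) (k b) = g ** so4_of a b ** transpose g"
    and "linear f" "linear k"
  shows "jclass (f x) (f y) (k p) (k q) = jclass x y p q"
  unfolding jclass_def
  by (rule bracket_class_conj[OF jmap_in_Hom jmap_in_Hom assms(1) orthogonal_matrix_id, symmetric])
    (simp add: jmap_def assms(2)[symmetric] linear_add[OF assms(3)] linear_cmul[OF assms(3)]
      linear_add[OF assms(4)] linear_cmul[OF assms(4)])

text \<open>Rotations about the third and the first axis suffice for the reductions below, in the
  manner of Euler angles.\<close>

definition rot3 :: "real \<Rightarrow> real^3 \<Rightarrow> real^3" where
  "rot3 t a = vector [cos t * a $ 1 - sin t * a $ 2, sin t * a $ 1 + cos t * a $ 2, a $ 3]"

definition rot1 :: "real \<Rightarrow> real^3 \<Rightarrow> real^3" where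
  "rot1 t a = vector [a $ 1, cos t * a $ 2 - sin t * a $ 3, sin t * a $ 2 + cos t * a $ 3]"

text \<open>A reflection of R^4 in the fourth coordinate exchanges the bases of the two ideals only
  up to the sign of the third vector; \<open>flip3\<close> records that sign.\<close>

definition flip3 :: "real^3 \<Rightarrow> real^3" where
  "flip3 a = vector [a $ 1, a $ 2, - a $ 3]"

lemma rot_nth [simp]:
  "rot3 t a $ 1 = cos t * a $ 1 - sin t * a $ 2" "rot3 t a $ 2 = sin t * a $ 1 + cos t * a $ 2"
  "rot3 t a $ 3 = a $ 3"
  "rot1 t a $ 1 = a $ 1" "rot1 t a $ 2 = cos t * a $ 2 - sin t * a $ 3"
  "rot1 t a $ 3 = sin t * a $ 2 + cos t * a $ 3"
  "flip3 a $ 1 = a $ 1" "flip3 a $ 2 = a $ 2" "flip3 a $ 3 = - a $ 3"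
  by (simp_all add: rot3_def rot1_def flip3_def)

lemma linear_rot: "linear (rot3 t)" "linear (rot1 t)" "linear flip3"
  by (auto intro!: linearI simp: vec_eq_iff forall_3 algebra_simps)

text \<open>Conjugation by \<open>c + s e\<close> with \<open>e\<close> a unit vector of the ideal \<open>\<real>\<^sup>3\<^sub>-\<close> (a unit quaternion)
  is the identity on \<open>\<real>\<^sup>3\<^sub>+\<close> and the rotation about \<open>e\<close> by twice the angle on \<open>\<real>\<^sup>3\<^sub>-\<close>.\<close>

definition quat :: "real \<Rightarrow> real^3 \<Rightarrow> real^4^4" where
  "quat t e = cos (t / 2) *\<^sub>R mat 1 + sin (t / 2) *\<^sub>R so4_of e 0"

lemma half_angle:
  fixes t :: real
  shows "cos t = cos (t / 2) * cos (t / 2) - sin (t / 2) * sin (t / 2)"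
    and "sin t = 2 * sin (t / 2) * cos (t / 2)"
    and "cos (t / 2) * cos (t / 2) + sin (t / 2) * sin (t / 2) = 1"
  using cos_add[of "t / 2" "t / 2"] sin_add[of "t / 2" "t / 2"] sin_cos_squared_add3[of "t / 2"]
  by (simp_all add: algebra_simps)

lemma jclass_rot3: "jclass (rot3 t x) (rot3 t y) p q = jclass x y p q"
proof (rule jclass_conj[where g = "quat t (axis 3 1)", OF _ _ linear_rot(1) linear_id[unfolded id_def]])
  define c s where "c = cos (t / 2)" and "s = sin (t / 2)"
  have cs: "c * c + s * s = 1" "cos t = c * c - s * s" "sin t = 2 * s * c"
    using half_angle[of t] by (simp_all add: c_def s_def)
  \<comment> \<open>Both forms eliminate squares of s, the second one inside right-nested products,
    so that the entrywise identities are decided by normalisation.\<close>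
  have ss: "s * s = 1 - c * c" "s * (s * r) = r - c * (c * r)" for r
    using cs(1) by algebra+
  show "orthogonal_matrix (quat t (axis 3 1))"
    unfolding orthogonal_matrix quat_def c_def[symmetric] s_def[symmetric]
    using cs(1) by (simp add: vec_eq_iff forall_4 matrix_matrix_mult_def sum_4 transpose_def mat_def
        axis_def algebra_simps)
  show "so4_of (rot3 t a) b = quat t (axis 3 1) ** so4_of a b ** transpose (quat t (axis 3 1))" for a b
    unfolding quat_def c_def[symmetric] s_def[symmetric]
    by (simp add: vec_eq_iff forall_4 matrix_matrix_mult_def sum_4 transpose_def mat_def axis_def cs)
      (simp add: algebra_simps ss)
qed

lemma jclass_rot1: "jclass (rot1 t x) (rot1 t y) p q = jclass x y p q"
proof (rule jclass_conj[where g = "quat t (axis 1 1)", OF _ _ linear_rot(2) linear_id[unfolded id_def]])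
  define c s where "c = cos (t / 2)" and "s = sin (t / 2)"
  have cs: "c * c + s * s = 1" "cos t = c * c - s * s" "sin t = 2 * s * c"
    using half_angle[of t] by (simp_all add: c_def s_def)
  have ss: "s * s = 1 - c * c" "s * (s * r) = r - c * (c * r)" for r
    using cs(1) by algebra+
  show "orthogonal_matrix (quat t (axis 1 1))"
    unfolding orthogonal_matrix quat_def c_def[symmetric] s_def[symmetric]
    using cs(1) by (simp add: vec_eq_iff forall_4 matrix_matrix_mult_def sum_4 transpose_def mat_def
        axis_def algebra_simps)
  show "so4_of (rot1 t a) b = quat t (axis 1 1) ** so4_of a b ** transpose (quat t (axis 1 1))" for a b
    unfolding quat_def c_def[symmetric] s_def[symmetric]
    by (simp add: vec_eq_iff forall_4 matrix_matrix_mult_def sum_4 transpose_def mat_def axis_def cs)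
      (simp add: algebra_simps ss)
qed

text \<open>Conjugation by diag(1, 1, 1, -1), an element of O(4) of determinant -1, interchanges the
  two ideals.\<close>

lemma jclass_swap: "jclass (flip3 p) (flip3 q) (flip3 x) (flip3 y) = jclass x y p q"
proof -
  define g :: "real^4^4" where "g = (\<chi> i j. if i = j then if i = 4 then - 1 else 1 else 0)"
  have g: "orthogonal_matrix g"
    by (simp add: orthogonal_matrix g_def vec_eq_iff forall_4 matrix_matrix_mult_def sum_4
        transpose_def mat_def)
  have "so4_of (flip3 b) (flip3 a) = g ** so4_of a b ** transpose g" for a b
    by (simp add: g_def vec_eq_iff forall_4 matrix_matrix_mult_def sum_4 transpose_def)
  then show ?thesis
    unfolding jclass_def
    by (intro bracket_class_conj[OF jmap_in_Hom jmap_in_Hom g orthogonal_matrix_id, symmetric])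
      (simp add: jmap_def linear_add[OF linear_rot(3), symmetric]
        linear_cmul[OF linear_rot(3), symmetric])
qed

text \<open>Here O(4) acts by the identity and O(2) by a rotation. Together with the reflection in
  \<open>jclass_plane_reflect\<close> these rotations generate O(2).\<close>

lemma jclass_plane_rot:
  "jclass (cos t *\<^sub>R x - sin t *\<^sub>R y) (sin t *\<^sub>R x + cos t *\<^sub>R y)
     (cos t *\<^sub>R p - sin t *\<^sub>R q) (sin t *\<^sub>R p + cos t *\<^sub>R q) = jclass x y p q"
proof -
  define h :: "real^2^2" where "h = vector [vector [cos t, - sin t], vector [sin t, cos t]]"
  have cs: "sin t * sin t = 1 - cos t * cos t" "sin t * (sin t * r) = r - cos t * (cos t * r)" for r
    using sin_cos_squared_add3[of t] by algebra+
  have h: "orthogonal_matrix h"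
    by (simp add: orthogonal_matrix h_def vec_eq_iff forall_2 matrix_matrix_mult_def sum_2
        transpose_def mat_def cs)
  show ?thesis
    unfolding jclass_def
    by (rule bracket_class_conj[OF jmap_in_Hom jmap_in_Hom orthogonal_matrix_id h, symmetric])
      (simp add: jmap_def h_def vec_eq_iff forall_4 matrix_vector_mult_def sum_2 algebra_simps cs
        transpose_mat)
qed

lemma jclass_plane_reflect: "jclass x (- y) p (- q) = jclass x y p q"
proof -
  define h :: "real^2^2" where "h = vector [vector [1, 0], vector [0, - 1]]"
  have h: "orthogonal_matrix h"
    by (simp add: orthogonal_matrix h_def vec_eq_iff forall_2 matrix_matrix_mult_def sum_2
        transpose_def mat_def)
  show ?thesis
    unfolding jclass_def
    by (rule bracket_class_conj[OF jmap_in_Hom jmap_in_Hom orthogonal_matrix_id h, symmetric])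
      (simp add: jmap_def h_def vec_eq_iff forall_4 matrix_vector_mult_def sum_2 transpose_mat)
qed

section \<open>Gram matrices and normal forms\<close>

text \<open>The Gram matrix of \<open>x, y\<close> is \<open>m I\<close> plus the traceless symmetric matrix with entries
  \<open>u, v, v, -u\<close>; so its eigenvalues are \<open>m - r\<close> and \<open>m + r\<close> with \<open>r = sqrt (u\<^sup>2 + v\<^sup>2)\<close>, and
  rotating the basis of \<open>\<real>\<^sup>2\<close> by \<open>t\<close> rotates \<open>(u, v)\<close> by \<open>2 t\<close>.\<close>

definition gram_m :: "'a::real_inner \<Rightarrow> 'a \<Rightarrow> real" where
  "gram_m x y = (x \<bullet> x + y \<bullet> y) / 2"

definition gram_u :: "'a::real_inner \<Rightarrow> 'a \<Rightarrow> real" where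
  "gram_u x y = (x \<bullet> x - y \<bullet> y) / 2"

definition gram_r :: "'a::real_inner \<Rightarrow> 'a \<Rightarrow> real" where
  "gram_r x y = sqrt ((gram_u x y)\<^sup>2 + (x \<bullet> y)\<^sup>2)"

text \<open>The last entry is the trace of the product of the two Gram matrices: the scalar parts
  contribute twice the product of the \<open>gram_m\<close>, and the traceless parts twice the inner
  product of their vectors (u, v).\<close>

definition inv5 :: "real^3 \<Rightarrow> real^3 \<Rightarrow> real^3 \<Rightarrow> real^3 \<Rightarrow> real5" where
  "inv5 x y p q = (gram_m x y - gram_r x y, gram_m x y + gram_r x y,
     gram_m p q - gram_r p q, gram_m p q + gram_r p q,
     2 * (gram_m x y * gram_m p q + gram_u x y * gram_u p q + (x \<bullet> y) * (p \<bullet> q)))"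

lemma matrix_adjoint_comp:
  fixes f :: "real^2 \<Rightarrow> real^3"
  assumes "\<And>z. f z = z $ 1 *\<^sub>R x + z $ 2 *\<^sub>R y"
  shows "matrix (adjoint f \<circ> f) = vector [vector [x \<bullet> x, x \<bullet> y], vector [x \<bullet> y, y \<bullet> y]]"
proof -
  have "linear f" by (rule linearI) (simp_all add: assms algebra_simps)
  have "matrix (adjoint f \<circ> f) $ i $ k = f (axis i 1) \<bullet> f (axis k 1)" for i k
    using adjoint_works[OF \<open>linear f\<close>, of "axis i 1" "f (axis k 1)"]
    by (simp add: matrix_def inner_axis' inner_commute)
  then show ?thesis
    by (simp add: vec_eq_iff forall_2 assms axis_def inner_commute)
qed

lemma Spec_adjoint_comp:
  fixes f :: "real^2 \<Rightarrow> real^3"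
  assumes "\<And>z. f z = z $ 1 *\<^sub>R x + z $ 2 *\<^sub>R y"
  shows "Spec (adjoint f \<circ> f) = (gram_m x y - gram_r x y, gram_m x y + gram_r x y)"
proof (rule Spec_eqI)
  show "gram_m x y - gram_r x y \<le> gram_m x y + gram_r x y"
    by (simp add: gram_r_def)
  fix t
  have r: "gram_r x y * gram_r x y = (gram_u x y)\<^sup>2 + (x \<bullet> y)\<^sup>2"
    unfolding gram_r_def by simp
  have "(t - (gram_m x y - gram_r x y)) * (t - (gram_m x y + gram_r x y)) =
      (t - gram_m x y)\<^sup>2 - gram_r x y * gram_r x y"
    by (simp add: power2_eq_square algebra_simps)
  also have "\<dots> = (t - x \<bullet> x) * (t - y \<bullet> y) - (x \<bullet> y) * (x \<bullet> y)"
    unfolding r by (simp add: gram_u_def gram_m_def power2_eq_square field_simps)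
  also have "\<dots> = det (mat t - matrix (adjoint f \<circ> f))"
    by (simp add: matrix_adjoint_comp[OF assms] det_2 mat_def)
  finally show "det (mat t - matrix (adjoint f \<circ> f)) =
      (t - (gram_m x y - gram_r x y)) * (t - (gram_m x y + gram_r x y))" ..
qed

lemma invariants_jmap: "invariants (jmap x y p q) = inv5 x y p q"
proof -
  have "linear (j_minus (jmap x y p q))" "linear (j_plus (jmap x y p q))"
    by (auto intro!: linearI simp: j_minus_jmap j_plus_jmap algebra_simps)
  then have lin: "linear (adjoint (j_minus (jmap x y p q)) \<circ> j_minus (jmap x y p q))"
    "linear (adjoint (j_plus (jmap x y p q)) \<circ> j_plus (jmap x y p q))"
    by (auto intro!: linear_compose adjoint_linear)
  show ?thesis
    unfolding invariants_def Let_def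
      Spec_adjoint_comp[OF j_minus_jmap] Spec_adjoint_comp[OF j_plus_jmap] prod.case
      matrix_compose[OF lin] matrix_adjoint_comp[OF j_minus_jmap] matrix_adjoint_comp[OF j_plus_jmap]
    by (simp add: inv5_def trace_def sum_2 matrix_matrix_mult_def gram_m_def gram_u_def field_simps)
qed

text \<open>The difference of the squares is the Gram determinant, nonnegative by
  Cauchy-Schwarz.\<close>

lemma gram_r_le_m: "gram_r x y \<le> gram_m x y"
proof -
  have "(gram_u x y)\<^sup>2 + (x \<bullet> y)\<^sup>2 \<le> (gram_m x y)\<^sup>2"
    using Cauchy_Schwarz_ineq[of x y]
    by (simp add: gram_u_def gram_m_def power2_eq_square field_simps)
  then show ?thesis
    unfolding gram_r_def by (rule real_le_lsqrt[rotated]) (simp add: gram_m_def)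
qed

lemma gram_r_nonneg [simp]: "0 \<le> gram_r x y"
  by (simp add: gram_r_def)

text \<open>With means m, n and radii r, s the interval for t is [2(mn - rs), 2(mn + rs)].
  Membership of the trace is Cauchy-Schwarz in the plane for the two vectors (u, v).\<close>

lemma inv5_in_S_hat: "inv5 x y p q \<in> S_hat"
proof -
  have "\<bar>gram_u x y * gram_u p q + (x \<bullet> y) * (p \<bullet> q)\<bar> \<le> gram_r x y * gram_r p q"
    using Cauchy_Schwarz_ineq2[of "(gram_u x y, x \<bullet> y)" "(gram_u p q, p \<bullet> q)"]
    by (simp add: gram_r_def norm_Pair)
  then show ?thesis
    using gram_r_le_m[of x y] gram_r_le_m[of p q]
    by (simp add: inv5_def S_hat_def algebra_simps abs_le_iff)
qed

lemma inner_3: "(x::real^3) \<bullet> y = x $ 1 * y $ 1 + x $ 2 * y $ 2 + x $ 3 * y $ 3"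
  by (simp add: inner_vec_def sum_3)

lemma rot_inner [simp]:
  "rot3 t x \<bullet> rot3 t y = x \<bullet> y" "rot1 t x \<bullet> rot1 t y = x \<bullet> y" "flip3 x \<bullet> flip3 y = x \<bullet> y"
proof -
  have cs: "sin t * sin t = 1 - cos t * cos t" "sin t * (sin t * r) = r - cos t * (cos t * r)" for r
    using sin_cos_squared_add3[of t] by algebra+
  show "rot3 t x \<bullet> rot3 t y = x \<bullet> y" "rot1 t x \<bullet> rot1 t y = x \<bullet> y" "flip3 x \<bullet> flip3 y = x \<bullet> y"
    by (simp_all add: inner_3 algebra_simps cs)
qed

section \<open>Normal form of a pair of vectors under rotations of R^3\<close>

lemma ex_rotation_angle:
  fixes a b :: real
  shows "\<exists>t. sin t * a + cos t * b = 0 \<and> cos t * a - sin t * b = sqrt (a\<^sup>2 + b\<^sup>2)"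
proof (cases "a = 0 \<and> b = 0")
  case False
  define r where "r = sqrt (a\<^sup>2 + b\<^sup>2)"
  have r: "r * r = a\<^sup>2 + b\<^sup>2" "r \<noteq> 0"
    using False by (auto simp: r_def sum_power2_eq_zero_iff)
  have "(a / r)\<^sup>2 + (- b / r)\<^sup>2 = (a\<^sup>2 + b\<^sup>2) / (r * r)"
    by (simp add: power_divide power2_eq_square add_divide_distrib)
  also have "\<dots> = 1"
    using r(2) unfolding r(1)[symmetric] by simp
  finally have "(a / r)\<^sup>2 + (- b / r)\<^sup>2 = 1" .
  then obtain t where "a / r = cos t" "- b / r = sin t"
    by (rule sincos_total_2pi)
  then have t: "cos t = a / r" "sin t = - b / r" by simp_all
  have "cos t * a - sin t * b = (a\<^sup>2 + b\<^sup>2) / r"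
    by (simp add: t power2_eq_square add_divide_distrib)
  also have "\<dots> = r" using r by (simp add: r(1)[symmetric])
  finally show ?thesis by (intro exI[of _ t]) (simp add: t r_def)
qed simp

lemma ex_rotation_angle_nonneg:
  fixes a b :: real
  shows "\<exists>t. sin t * a + cos t * b = 0 \<and> 0 \<le> cos t * a - sin t * b"
  using ex_rotation_angle[of a b] by (metis real_sqrt_ge_zero sum_power2_ge_zero)

text \<open>A QR decomposition by Euler angles: two rotations carry x to the nonnegative first axis,
  and a third one, about that axis, moves y into the half-plane where the second coordinate is
  nonnegative and the third is 0. The sign conditions make a, b, c unique for a given Gram
  matrix.\<close>

lemma ex_gram_normal_form:
  fixes x y :: "real^3"
  shows "\<exists>a b c. 0 \<le> a \<and> 0 \<le> c \<and> (a = 0 \<longrightarrow> c = 0 \<and> 0 \<le> b) \<and>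
    x \<bullet> x = a * a \<and> x \<bullet> y = a * b \<and> y \<bullet> y = b * b + c * c \<and>
    (\<forall>p q. jclass x y p q = jclass (vector [a, 0, 0]) (vector [b, c, 0]) p q)"
proof -
  define R where "R x y x' y' \<longleftrightarrow> x' \<bullet> x' = x \<bullet> x \<and> x' \<bullet> y' = x \<bullet> y \<and> y' \<bullet> y' = y \<bullet> y \<and>
    (\<forall>p q. jclass x' y' p q = jclass x y p q)" for x y x' y'
  have R_trans: "R x y x'' y''" if "R x y x' y'" "R x' y' x'' y''" for x y x' y' x'' y''
    using that by (simp add: R_def)
  have R1: "R x y (rot1 t x) (rot1 t y)" and R3: "R x y (rot3 t x) (rot3 t y)" for x y t
    by (simp_all add: R_def jclass_rot1 jclass_rot3)
  obtain t1 where t1: "sin t1 * x $ 2 + cos t1 * x $ 3 = 0"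
    using ex_rotation_angle by metis
  define x1 y1 where "x1 = rot1 t1 x" and "y1 = rot1 t1 y"
  obtain t2 where t2: "sin t2 * x1 $ 1 + cos t2 * x1 $ 2 = 0" "cos t2 * x1 $ 1 - sin t2 * x1 $ 2 \<ge> 0"
    using ex_rotation_angle_nonneg by blast
  define x2 y2 where "x2 = rot3 t2 x1" and "y2 = rot3 t2 y1"
  obtain t3 where t3: "sin t3 * y2 $ 2 + cos t3 * y2 $ 3 = 0" "cos t3 * y2 $ 2 - sin t3 * y2 $ 3 \<ge> 0"
    using ex_rotation_angle_nonneg by blast
  define x3 y3 where "x3 = rot1 t3 x2" and "y3 = rot1 t3 y2"
  have R13: "R x y x3 y3"
    unfolding x3_def y3_def x2_def y2_def x1_def y1_def by (blast intro: R_trans R1 R3)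
  have x2: "x2 $ 1 \<ge> 0" "x2 $ 2 = 0" "x2 $ 3 = 0"
    using t1 t2 by (simp_all add: x2_def x1_def)
  have x3: "x3 = vector [x2 $ 1, 0, 0]"
    using x2 by (simp add: x3_def vec_eq_iff forall_3)
  have y3: "y3 $ 2 \<ge> 0" "y3 $ 3 = 0"
    using t3 by (simp_all add: y3_def)
  have y3_eq: "y3 = vector [y3 $ 1, y3 $ 2, 0]"
    using y3 by (simp add: vec_eq_iff forall_3)
  have fin: ?thesis if "0 \<le> a" "0 \<le> c" "a = 0 \<longrightarrow> c = 0 \<and> 0 \<le> b"
    "R x y (vector [a, 0, 0]) (vector [b, c, 0])" for a b c
    using that unfolding R_def
    by (intro exI[of _ a] exI[of _ b] exI[of _ c]) (simp add: inner_3)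
  show ?thesis
  proof (cases "x2 $ 1 = 0")
    case False
    then show ?thesis
      using R13 x2(1) y3(1) by (intro fin[of "x2 $ 1" "y3 $ 2" "y3 $ 1"]) (auto simp: x3 y3_eq[symmetric])
  next
    case True
    \<comment> \<open>Now \<open>x3\<close> is zero, so a rotation about the third axis is still
      free to move \<open>y3\<close> onto the nonnegative first axis.\<close>
    obtain t4 where t4: "sin t4 * y3 $ 1 + cos t4 * y3 $ 2 = 0" "cos t4 * y3 $ 1 - sin t4 * y3 $ 2 \<ge> 0"
      using ex_rotation_angle_nonneg by blast
    have "rot3 t4 x3 = vector [0, 0, 0]"
      using True by (simp add: x3 vec_eq_iff forall_3)
    moreover have "rot3 t4 y3 = vector [rot3 t4 y3 $ 1, 0, 0]" "0 \<le> rot3 t4 y3 $ 1"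
      using t4 y3 by (simp_all add: vec_eq_iff forall_3)
    ultimately show ?thesis
      using R_trans[OF R13 R3[of x3 y3 t4]] by (intro fin[of 0 0 "rot3 t4 y3 $ 1"]) auto
  qed
qed

text \<open>The Gram matrix determines the normal form: first a, then b by division by a, then c. If
  a = 0, then c = 0 and b is the nonnegative root of the last Gram entry.\<close>

lemma jclass_cong_minus:
  assumes "x \<bullet> x = x' \<bullet> x'" "x \<bullet> y = x' \<bullet> y'" "y \<bullet> y = y' \<bullet> y'"
  shows "jclass x y p q = jclass x' y' p q"
proof -
  obtain a b c where n: "0 \<le> a" "0 \<le> c" "a = 0 \<longrightarrow> c = 0 \<and> 0 \<le> b"
    "x \<bullet> x = a * a" "x \<bullet> y = a * b" "y \<bullet> y = b * b + c * c"
    "\<And>p q. jclass x y p q = jclass (vector [a, 0, 0]) (vector [b, c, 0]) p q"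
    using ex_gram_normal_form[of x y] by blast
  obtain a' b' c' where n': "0 \<le> a'" "0 \<le> c'" "a' = 0 \<longrightarrow> c' = 0 \<and> 0 \<le> b'"
    "x' \<bullet> x' = a' * a'" "x' \<bullet> y' = a' * b'" "y' \<bullet> y' = b' * b' + c' * c'"
    "\<And>p q. jclass x' y' p q = jclass (vector [a', 0, 0]) (vector [b', c', 0]) p q"
    using ex_gram_normal_form[of x' y'] by blast
  have sq: "r = s" if "r * r = s * s" "0 \<le> r" "0 \<le> s" for r s :: real
    using that by (metis abs_of_nonneg real_sqrt_abs2)
  have a: "a = a'" by (rule sq) (use assms(1) n n' in auto)
  have "b = b' \<and> c = c'"
  proof (cases "a = 0")
    case True
    have "c = c'" using True a n n' by auto
    moreover have "b = b'" by (rule sq) (use True a n n' assms(3) in auto)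
    ultimately show ?thesis by simp
  next
    case False
    then have "b = b'" using a n n' assms(2) by simp
    moreover have "c = c'" by (rule sq) (use \<open>b = b'\<close> n n' assms(3) in auto)
    ultimately show ?thesis by simp
  qed
  with a show ?thesis by (simp add: n(7) n'(7))
qed

text \<open>The plus component is treated by exchanging the ideals, using the result for the minus
  component, and exchanging back.\<close>

lemma jclass_cong:
  assumes "x \<bullet> x = x' \<bullet> x'" "x \<bullet> y = x' \<bullet> y'" "y \<bullet> y = y' \<bullet> y'"
    and "p \<bullet> p = p' \<bullet> p'" "p \<bullet> q = p' \<bullet> q'" "q \<bullet> q = q' \<bullet> q'"
  shows "jclass x y p q = jclass x' y' p' q'"
proof -
  have "jclass x y p q = jclass x' y' p q"
    by (rule jclass_cong_minus[OF assms(1-3)])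
  also have "\<dots> = jclass (flip3 p) (flip3 q) (flip3 x') (flip3 y')"
    by (rule jclass_swap[symmetric])
  also have "\<dots> = jclass (flip3 p') (flip3 q') (flip3 x') (flip3 y')"
    by (rule jclass_cong_minus) (simp_all add: assms)
  also have "\<dots> = jclass x' y' p' q'"
    by (rule jclass_swap)
  finally show ?thesis .
qed

section \<open>Simultaneous action of O(2) on the two Gram matrices\<close>

lemma gram_plane_rot:
  fixes x y :: "'a::real_inner"
  defines "x' \<equiv> \<lambda>t. cos t *\<^sub>R x - sin t *\<^sub>R y" and "y' \<equiv> \<lambda>t. sin t *\<^sub>R x + cos t *\<^sub>R y"
  shows "gram_m (x' t) (y' t) = gram_m x y"
    and "gram_u (x' t) (y' t) = cos (2 * t) * gram_u x y - sin (2 * t) * (x \<bullet> y)"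
    and "x' t \<bullet> y' t = sin (2 * t) * gram_u x y + cos (2 * t) * (x \<bullet> y)"
proof -
  have cs: "sin t * sin t = 1 - cos t * cos t" "sin t * (sin t * r) = r - cos t * (cos t * r)" for r
    using sin_cos_squared_add3[of t] by algebra+
  show "gram_m (x' t) (y' t) = gram_m x y"
    "gram_u (x' t) (y' t) = cos (2 * t) * gram_u x y - sin (2 * t) * (x \<bullet> y)"
    "x' t \<bullet> y' t = sin (2 * t) * gram_u x y + cos (2 * t) * (x \<bullet> y)"
    unfolding sin_double cos_double
    by (simp_all add: x'_def y'_def gram_m_def gram_u_def inner_diff_left inner_diff_right
        inner_add_left inner_add_right inner_commute[of y x] power2_eq_square
        algebra_simps add_divide_distrib diff_divide_distrib cs)
qed

lemma inv5_plane_rot: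
  "inv5 (cos t *\<^sub>R x - sin t *\<^sub>R y) (sin t *\<^sub>R x + cos t *\<^sub>R y)
     (cos t *\<^sub>R p - sin t *\<^sub>R q) (sin t *\<^sub>R p + cos t *\<^sub>R q) = inv5 x y p q"
proof -
  define c s where "c = cos (2 * t)" and "s = sin (2 * t)"
  have cs: "s * s = 1 - c * c" "s * (s * r) = r - c * (c * r)" for r
    using sin_cos_squared_add3[of "2 * t"] unfolding c_def s_def by algebra+
  show ?thesis
    unfolding inv5_def gram_r_def gram_plane_rot c_def[symmetric] s_def[symmetric]
    by (simp add: power2_eq_square algebra_simps cs)
qed

text \<open>A rotation moves the traceless part (u, v) of the first Gram matrix to the nonnegative
  first axis. If that part is zero, a further rotation does the same for the second Gram matrix;
  otherwise the reflection of the plane can still correct the sign of the second v.\<close>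

lemma ex_plane_normal_form:
  fixes x y p q :: "real^3"
  shows "\<exists>x' y' p' q'. jclass x' y' p' q' = jclass x y p q \<and> inv5 x' y' p' q' = inv5 x y p q \<and>
    x' \<bullet> y' = 0 \<and> 0 \<le> gram_u x' y' \<and> 0 \<le> p' \<bullet> q' \<and>
    (gram_u x' y' = 0 \<longrightarrow> p' \<bullet> q' = 0 \<and> 0 \<le> gram_u p' q')"
proof -
  define R where "R t x y p q x' y' p' q' \<longleftrightarrow> jclass x' y' p' q' = jclass x y p q \<and>
      inv5 x' y' p' q' = inv5 x y p q \<and>
      gram_u x' y' = cos t * gram_u x y - sin t * (x \<bullet> y) \<and>
      x' \<bullet> y' = sin t * gram_u x y + cos t * (x \<bullet> y) \<and>
      gram_u p' q' = cos t * gram_u p q - sin t * (p \<bullet> q) \<and>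
      p' \<bullet> q' = sin t * gram_u p q + cos t * (p \<bullet> q)" for t and x y p q x' y' p' q' :: "real^3"
  \<comment> \<open>The half angle compensates for the doubling in
    \<open>gram_plane_rot\<close>.\<close>
  have rot: "\<exists>x' y' p' q'. R t x y p q x' y' p' q'" for t x y p q
    unfolding R_def
    using jclass_plane_rot[of "t / 2" x y p q] inv5_plane_rot[of "t / 2" x y p q]
      gram_plane_rot[of "t / 2" x y] gram_plane_rot[of "t / 2" p q]
    by (intro exI conjI) (assumption | simp)+
  obtain t where t: "sin t * gram_u x y + cos t * (x \<bullet> y) = 0"
    "cos t * gram_u x y - sin t * (x \<bullet> y) = sqrt ((gram_u x y)\<^sup>2 + (x \<bullet> y)\<^sup>2)"
    using ex_rotation_angle by blast
  obtain x' y' p' q' where n: "R t x y p q x' y' p' q'"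
    using rot by blast
  have xy: "x' \<bullet> y' = 0" "0 \<le> gram_u x' y'"
    using n t by (simp_all add: R_def)
  have j: "jclass x' y' p' q' = jclass x y p q" "inv5 x' y' p' q' = inv5 x y p q"
    using n by (simp_all add: R_def)
  consider "gram_u x' y' = 0" | "gram_u x' y' \<noteq> 0" "0 \<le> p' \<bullet> q'" | "gram_u x' y' \<noteq> 0" "p' \<bullet> q' < 0"
    by linarith
  then show ?thesis
  proof cases
    case 1
    obtain t where t: "sin t * gram_u p' q' + cos t * (p' \<bullet> q') = 0"
      "cos t * gram_u p' q' - sin t * (p' \<bullet> q') = sqrt ((gram_u p' q')\<^sup>2 + (p' \<bullet> q')\<^sup>2)"
      using ex_rotation_angle by blast
    obtain x'' y'' p'' q'' where n: "R t x' y' p' q' x'' y'' p'' q''"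
      using rot by blast
    show ?thesis
      using n 1 xy j t unfolding R_def
      by (intro exI[of _ x''] exI[of _ y''] exI[of _ p''] exI[of _ q'']) simp
  next
    case 2
    then show ?thesis using j xy by blast
  next
    case 3
    then show ?thesis
      using j xy
      by (intro exI[of _ x'] exI[of _ "- y'"] exI[of _ p'] exI[of _ "- q'"])
        (simp add: jclass_plane_reflect inv5_def gram_r_def gram_u_def gram_m_def)
  qed
qed

lemma gram_entries:
  "x \<bullet> x = gram_m x y + gram_u x y" "y \<bullet> y = gram_m x y - gram_u x y"
  by (simp_all add: gram_m_def gram_u_def field_simps)

text \<open>In normal form the invariants determine both Gram matrices. The first u equals its
  radius; the trace then gives the second u if the first is nonzero, and the second radius gives the
  nonnegative v. If the first u is zero, the second u is its own radius.\<close>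

lemma jclass_eq_if_inv5_eq:
  assumes "inv5 x y p q = inv5 x' y' p' q'"
  shows "jclass x y p q = jclass x' y' p' q'"
proof -
  obtain X Y P Q where n: "jclass X Y P Q = jclass x y p q" "inv5 X Y P Q = inv5 x y p q"
    "X \<bullet> Y = 0" "0 \<le> gram_u X Y" "0 \<le> P \<bullet> Q" "gram_u X Y = 0 \<longrightarrow> P \<bullet> Q = 0 \<and> 0 \<le> gram_u P Q"
    using ex_plane_normal_form[of x y p q] by blast
  obtain X' Y' P' Q' where n': "jclass X' Y' P' Q' = jclass x' y' p' q'" "inv5 X' Y' P' Q' = inv5 x' y' p' q'"
    "X' \<bullet> Y' = 0" "0 \<le> gram_u X' Y'" "0 \<le> P' \<bullet> Q'" "gram_u X' Y' = 0 \<longrightarrow> P' \<bullet> Q' = 0 \<and> 0 \<le> gram_u P' Q'"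
    using ex_plane_normal_form[of x' y' p' q'] by blast
  have eq: "inv5 X Y P Q = inv5 X' Y' P' Q'"
    by (simp add: n n' assms)
  have m: "gram_m X Y = gram_m X' Y'" "gram_m P Q = gram_m P' Q'"
    and r: "gram_r X Y = gram_r X' Y'" "gram_r P Q = gram_r P' Q'"
    using eq unfolding inv5_def prod.inject by linarith+
  have u: "gram_u X Y = gram_u X' Y'"
    using r(1) n n' by (simp add: gram_r_def)
  have t: "gram_u X Y * gram_u P Q = gram_u X Y * gram_u P' Q'"
    using eq unfolding inv5_def prod.inject by (simp add: m u n n')
  have r2: "(gram_u P Q)\<^sup>2 + (P \<bullet> Q)\<^sup>2 = (gram_u P' Q')\<^sup>2 + (P' \<bullet> Q')\<^sup>2"
    using r(2) by (simp add: gram_r_def)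
  have "gram_u P Q = gram_u P' Q' \<and> P \<bullet> Q = P' \<bullet> Q'"
  proof (cases "gram_u X Y = 0")
    case True
    then show ?thesis
      using n n' u r2 by (simp add: power2_eq_iff_nonneg)
  next
    case False
    then show ?thesis
      using t r2 n n' by (simp add: power2_eq_iff_nonneg)
  qed
  then have "jclass X Y P Q = jclass X' Y' P' Q'"
    using m u n(3) n'(3)
    by (intro jclass_cong)
      (simp_all add: gram_entries[where x = X and y = Y] gram_entries[where x = X' and y = Y']
        gram_entries[where x = P and y = Q] gram_entries[where x = P' and y = Q'])
  then show ?thesis by (simp add: n n')
qed

section \<open>Invariance under the orthogonal group\<close>

definition form_matrix :: "(real^'n \<Rightarrow> real^'n \<Rightarrow> real) \<Rightarrow> real^'n^'n" where
  "form_matrix \<beta> = (\<chi> a b. \<beta> (axis a 1) (axis b 1))"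

lemma matrix_entry: "axis a 1 \<bullet> (M *v axis b 1) = M $ a $ b" for M :: "real^'n^'m"
  by (simp add: inner_axis' matrix_vector_mult_basis column_def)

lemma bilinear_form_matrix:
  assumes "bilinear \<beta>"
  shows "\<beta> u v = u \<bullet> (form_matrix \<beta> *v v)"
proof -
  have exp: "u = (\<Sum>k\<in>UNIV. u $ k *\<^sub>R axis k 1)" for u :: "real^'n"
    using basis_expansion[of u] by (simp add: scalar_mult_eq_scaleR)
  have lin: "linear (\<lambda>u. \<beta> u v)" "linear (\<beta> u)" for u v
    using assms by (simp_all add: bilinear_def)
  have "\<beta> u v = \<beta> (\<Sum>k\<in>UNIV. u $ k *\<^sub>R axis k 1) v"
    using exp[of u] by simp
  also have "\<dots> = (\<Sum>k\<in>UNIV. u $ k * \<beta> (axis k 1) v)"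
    by (simp add: linear_sum[OF lin(1)] linear_cmul[OF lin(1)])
  also have "\<dots> = (\<Sum>k\<in>UNIV. u $ k * (form_matrix \<beta> *v v) $ k)"
  proof (rule sum.cong[OF refl])
    fix k
    have "\<beta> (axis k 1) v = \<beta> (axis k 1) (\<Sum>l\<in>UNIV. v $ l *\<^sub>R axis l 1)"
      using exp[of v] by simp
    then have "\<beta> (axis k 1) v = (form_matrix \<beta> *v v) $ k"
      by (simp add: linear_sum[OF lin(2)] linear_cmul[OF lin(2)] form_matrix_def
          matrix_vector_mult_def mult.commute)
    then show "u $ k * \<beta> (axis k 1) v = u $ k * (form_matrix \<beta> *v v) $ k" by simp
  qed
  finally show ?thesis by (simp add: inner_vec_def)
qed

lemma form_matrix_transform:
  assumes "bilinear \<beta>"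
  shows "form_matrix (\<lambda>u v. \<beta> (Q u) (Q v)) = transpose (matrix Q) ** form_matrix \<beta> ** matrix Q"
proof -
  have Q: "matrix Q *v axis a 1 = Q (axis a 1)" for a
    by (simp add: matrix_vector_mult_basis column_def matrix_def vec_eq_iff)
  have "(transpose (matrix Q) ** form_matrix \<beta> ** matrix Q) $ a $ b = \<beta> (Q (axis a 1)) (Q (axis b 1))" for a b
  proof -
    have "(transpose (matrix Q) ** form_matrix \<beta> ** matrix Q) $ a $ b =
        axis a 1 \<bullet> (transpose (matrix Q) *v (form_matrix \<beta> *v (matrix Q *v axis b 1)))"
      by (simp only: matrix_entry[symmetric] matrix_vector_mul_assoc matrix_mul_assoc)
    also have "\<dots> = (matrix Q *v axis a 1) \<bullet> (form_matrix \<beta> *v (matrix Q *v axis b 1))"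
      by (metis dot_lmul_matrix inner_commute transpose_matrix_vector)
    finally show ?thesis by (simp only: Q bilinear_form_matrix[OF assms])
  qed
  then show ?thesis by (simp add: form_matrix_def vec_eq_iff)
qed

lemma orthogonal_conj_mult:
  fixes R :: "real^'n^'n"
  assumes "orthogonal_matrix R"
  shows "(transpose R ** A ** R) ** (transpose R ** B ** R) = transpose R ** (A ** B) ** R"
proof -
  have "(transpose R ** A ** R) ** (transpose R ** B ** R) =
      transpose R ** A ** (R ** transpose R) ** B ** R"
    by (simp add: matrix_mul_assoc)
  also have "\<dots> = transpose R ** A ** B ** R"
    using assms by (simp add: orthogonal_matrix_def)
  finally show ?thesis
    by (simp add: matrix_mul_assoc)
qed

lemma trace_orthogonal_conj:
  fixes R :: "real^'n^'n"
  assumes "orthogonal_matrix R"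
  shows "trace (transpose R ** A ** R) = trace A"
proof -
  have "trace (transpose R ** A ** R) = trace (R ** (transpose R ** A))"
    by (rule trace_mul_sym)
  then show ?thesis
    using assms by (simp add: orthogonal_matrix_def matrix_mul_assoc)
qed

text \<open>The matrix has M as its upper left block and zeros elsewhere; the form with
  \<open>proj4\<close> matches \<open>bracket_of\<close>.\<close>

definition pad6 :: "real^4^4 \<Rightarrow> real^6^6" where
  "pad6 M = (\<chi> a b. proj4 (axis a 1) \<bullet> (M *v proj4 (axis b 1)))"

lemma proj4_axis:
  "proj4 (axis 1 1) = axis 1 1" "proj4 (axis 2 1) = axis 2 1" "proj4 (axis 3 1) = axis 3 1"
  "proj4 (axis 4 1) = axis 4 1" "proj4 (axis 5 1) = 0" "proj4 (axis 6 1) = 0"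
  by (simp_all add: vec_eq_iff forall_4 axis_def)

lemma pad6_nth:
  "pad6 M $ a $ b = (proj4 (axis a 1)) \<bullet> (M *v proj4 (axis b 1))"
  by (simp add: pad6_def)

lemma trace_pad6: "trace (pad6 M) = trace M"
  by (simp add: trace_def sum_6 sum_4 pad6_nth proj4_axis matrix_entry)

lemma pad6_mult: "pad6 M ** pad6 N = pad6 (M ** N)"
  by (simp add: vec_eq_iff forall_6 matrix_matrix_mult_def sum_6 sum_4 pad6_nth proj4_axis matrix_entry)

lemma trace_so4_of_2: "trace (so4_of a b ** so4_of a b) = - 4 * (a \<bullet> a + b \<bullet> b)"
  by (simp add: trace_def matrix_matrix_mult_def sum_4 inner_3 algebra_simps)

text \<open>The two ideals behave like left and right imaginary quaternions: their elements commute
  with each other and square to minus the squared norm, so only the mixed product remains besides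
  scalars.\<close>

lemma so4_of_square:
  "so4_of a b ** so4_of a b = - (a \<bullet> a + b \<bullet> b) *\<^sub>R mat 1 + 2 *\<^sub>R (so4_of a 0 ** so4_of 0 b)"
  by (simp add: vec_eq_iff forall_4 matrix_matrix_mult_def sum_4 inner_3 mat_def algebra_simps)

text \<open>The mixed product N in \<open>so4_of_square\<close> is traceless and its square is the
  scalar |a|^2 |b|^2, so the trace of the squared expression has just two terms.\<close>

lemma trace_so4_of_4:
  "trace ((so4_of a b ** so4_of a b) ** (so4_of a b ** so4_of a b)) =
     4 * (a \<bullet> a + b \<bullet> b)\<^sup>2 + 16 * ((a \<bullet> a) * (b \<bullet> b))"
proof -
  have split: "trace ((k *\<^sub>R mat 1 + 2 *\<^sub>R N) ** (k *\<^sub>R mat 1 + 2 *\<^sub>R N)) =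
      4 * k\<^sup>2 + 4 * k * trace N + 4 * trace (N ** N)" for k and N :: "real^4^4"
    by (simp add: trace_def matrix_matrix_mult_def sum_4 mat_def power2_eq_square algebra_simps)
  have sq: "so4_of a 0 ** so4_of a 0 = - (a \<bullet> a) *\<^sub>R mat 1" "so4_of 0 b ** so4_of 0 b = - (b \<bullet> b) *\<^sub>R mat 1"
    by (simp_all add: vec_eq_iff forall_4 matrix_matrix_mult_def sum_4 inner_3 mat_def)
  have scal: "A ** (k *\<^sub>R mat 1) ** B = k *\<^sub>R (A ** B)" for A B :: "real^4^4" and k
    by (simp add: vec_eq_iff forall_4 matrix_matrix_mult_def sum_4 mat_def algebra_simps)
  have comm: "so4_of a 0 ** so4_of 0 b = so4_of 0 b ** so4_of a 0"
    by (simp add: vec_eq_iff forall_4 matrix_matrix_mult_def sum_4)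
  have "(so4_of a 0 ** so4_of 0 b) ** (so4_of a 0 ** so4_of 0 b) =
      (so4_of a 0 ** so4_of 0 b) ** (so4_of 0 b ** so4_of a 0)"
    by (simp only: comm)
  also have "\<dots> = so4_of a 0 ** (so4_of 0 b ** so4_of 0 b) ** so4_of a 0"
    by (simp only: matrix_mul_assoc)
  also have "\<dots> = ((a \<bullet> a) * (b \<bullet> b)) *\<^sub>R mat 1"
    unfolding sq scal by (simp add: sq)
  finally have "trace ((so4_of a 0 ** so4_of 0 b) ** (so4_of a 0 ** so4_of 0 b)) = 4 * ((a \<bullet> a) * (b \<bullet> b))"
    by (simp add: trace_def sum_4 mat_def)
  moreover have "trace (so4_of a 0 ** so4_of 0 b) = 0"
    by (simp add: trace_def matrix_matrix_mult_def sum_4)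
  ultimately show ?thesis
    unfolding so4_of_square split by (simp add: power2_eq_square algebra_simps)
qed

text \<open>A component of j composed with the projection of R^6 to coordinates 5 and 6. Being
  defined on R^6, it can be composed with isometries that do not preserve the splitting.\<close>

definition plane_map :: "real^3 \<Rightarrow> real^3 \<Rightarrow> real^6 \<Rightarrow> real^3" where
  "plane_map x y z = z $ 5 *\<^sub>R x + z $ 6 *\<^sub>R y"

lemma linear_plane_map: "linear (plane_map x y)"
  by (rule linearI) (simp_all add: plane_map_def algebra_simps)

lemma form_matrix_bracket_of_jmap:
  "form_matrix (\<lambda>u v. br (bracket_of (jmap x y p q)) u v \<bullet> z) = pad6 (so4_of (plane_map x y z) (plane_map p q z))"
proof -
  have "br (bracket_of (jmap x y p q)) u v \<bullet> z =
      proj4 u \<bullet> (so4_of (plane_map x y z) (plane_map p q z) *v proj4 v)" for u v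
  proof -
    have "br (bracket_of (jmap x y p q)) u v \<bullet> z = br (bracket_of (jmap x y p q)) u v \<bullet> incl2 (proj2 z)"
      by (simp add: bracket_of_apply inner_6)
    then show ?thesis
      by (simp add: inner_bracket_of[OF jmap_in_Hom] jmap_def plane_map_def)
  qed
  then show ?thesis by (simp add: form_matrix_def pad6_def)
qed

lemma bilinear_br_inner: "bilinear (\<lambda>u v. br c u v \<bullet> z)"
  by (auto simp: bilinear_def blinfun.add_left blinfun.add_right blinfun.scaleR_left
      blinfun.scaleR_right inner_add_left intro!: linearI)

text \<open>The skew matrices dual to the brackets at z and at \<open>Q z\<close> are conjugate by
  the orthogonal matrix of \<open>Q\<close>. Traces of their squares give the sum of the squared
  norms, traces of their fourth powers then the product.\<close>

lemma plane_map_norms_invariant: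
  assumes Q: "orthogonal_transformation Q"
    and eq: "\<And>u v. br (bracket_of (jmap x' y' p' q')) (Q u) (Q v) = Q (br (bracket_of (jmap x y p q)) u v)"
  defines "a \<equiv> \<lambda>z. plane_map x y z \<bullet> plane_map x y z" and "b \<equiv> \<lambda>z. plane_map p q z \<bullet> plane_map p q z"
    and "a' \<equiv> \<lambda>z. plane_map x' y' (Q z) \<bullet> plane_map x' y' (Q z)"
    and "b' \<equiv> \<lambda>z. plane_map p' q' (Q z) \<bullet> plane_map p' q' (Q z)"
  shows "a z + b z = a' z + b' z" "a z * b z = a' z * b' z"
proof -
  define M where "M = so4_of (plane_map x y z) (plane_map p q z)"
  define M' where "M' = so4_of (plane_map x' y' (Q z)) (plane_map p' q' (Q z))"
  define R where "R = matrix Q"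
  have R: "orthogonal_matrix R"
    using Q by (simp add: R_def orthogonal_transformation_matrix)
  have "Q u \<bullet> Q v = u \<bullet> v" for u v
    using Q by (simp add: orthogonal_transformation_def)
  then have "pad6 M = form_matrix (\<lambda>u v. br (bracket_of (jmap x' y' p' q')) (Q u) (Q v) \<bullet> Q z)"
    by (simp add: M_def form_matrix_bracket_of_jmap[symmetric] eq)
  also have "\<dots> = transpose R ** form_matrix (\<lambda>u v. br (bracket_of (jmap x' y' p' q')) u v \<bullet> Q z) ** R"
    unfolding R_def by (rule form_matrix_transform[OF bilinear_br_inner])
  also have "\<dots> = transpose R ** pad6 M' ** R"
    by (simp only: M'_def form_matrix_bracket_of_jmap)
  finally have M: "pad6 M = transpose R ** pad6 M' ** R" .
  have "trace (pad6 M ** pad6 M) = trace (pad6 M' ** pad6 M')"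
    unfolding M by (simp add: orthogonal_conj_mult[OF R] trace_orthogonal_conj[OF R])
  then show s: "a z + b z = a' z + b' z"
    by (simp add: pad6_mult trace_pad6 M_def M'_def trace_so4_of_2 a_def b_def a'_def b'_def)
  have "trace ((pad6 M ** pad6 M) ** (pad6 M ** pad6 M)) =
      trace ((pad6 M' ** pad6 M') ** (pad6 M' ** pad6 M'))"
    unfolding M by (simp add: orthogonal_conj_mult[OF R] trace_orthogonal_conj[OF R])
  then have "4 * (a z + b z)\<^sup>2 + 16 * (a z * b z) = 4 * (a' z + b' z)\<^sup>2 + 16 * (a' z * b' z)"
    unfolding pad6_mult trace_pad6 M_def M'_def trace_so4_of_4 a_def b_def a'_def b'_def .
  then show "a z * b z = a' z * b' z"
    by (simp add: s)
qed

text \<open>On a line through points where the first and the second form do not vanish, both forms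
  are nonzero polynomials.\<close>

lemma quadratic_forms_mult_eq_0:
  fixes F G :: "'a::real_vector \<Rightarrow> real"
  assumes F: "\<And>z w t. F (z + t *\<^sub>R w) = F z + t * f z w + t\<^sup>2 * F w"
    and G: "\<And>z w t. G (z + t *\<^sub>R w) = G z + t * g z w + t\<^sup>2 * G w"
    and FG: "\<And>z. F z = 0 \<or> G z = 0"
  shows "(\<forall>z. F z = 0) \<or> (\<forall>z. G z = 0)"
proof (rule ccontr)
  assume "\<not> ?thesis"
  then obtain z w where zw: "F z \<noteq> 0" "G w \<noteq> 0" by blast
  then have 0: "G z = 0" "F w = 0" using FG by blast+
  have "F z + t * f z w = 0 \<or> g z w + t * G w = 0" if "t \<noteq> 0" for t
  proof -
    have "t * g z w + t\<^sup>2 * G w = t * (g z w + t * G w)"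
      by (simp add: power2_eq_square algebra_simps)
    then show ?thesis
      using FG[of "z + t *\<^sub>R w"] that unfolding F G 0 by simp
  qed
  \<comment> \<open>Each of the two affine functions of t is nonzero and so has at most one zero;
    three values of t are too many.\<close>
  from this[of 1] this[of 2] this[of 3] show False
    using zw by auto
qed

lemma inner_self_line_expand:
  assumes "linear f"
  shows "f (z + t *\<^sub>R w) \<bullet> f (z + t *\<^sub>R w) = f z \<bullet> f z + t * (2 * (f z \<bullet> f w)) + t\<^sup>2 * (f w \<bullet> f w)"
  by (simp add: linear_add[OF assms] linear_cmul[OF assms] inner_add_left inner_add_right
      inner_commute[of "f w" "f z"] power2_eq_square algebra_simps)

text \<open>Equal sum and product give equal unordered pairs at each point. That the same matching
  works at all points is \<open>quadratic_forms_mult_eq_0\<close>, applied to the differences of the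
  forms.\<close>

lemma norms_eq_up_to_swap:
  assumes lin: "linear f" "linear g" "linear f'" "linear g'"
    and s: "\<And>z. f z \<bullet> f z + g z \<bullet> g z = f' z \<bullet> f' z + g' z \<bullet> g' z"
    and m: "\<And>z. (f z \<bullet> f z) * (g z \<bullet> g z) = (f' z \<bullet> f' z) * (g' z \<bullet> g' z)"
  shows "(\<forall>z. f z \<bullet> f z = f' z \<bullet> f' z \<and> g z \<bullet> g z = g' z \<bullet> g' z) \<or>
    (\<forall>z. f z \<bullet> f z = g' z \<bullet> g' z \<and> g z \<bullet> g z = f' z \<bullet> f' z)"
proof -
  have "(\<forall>z. f z \<bullet> f z - f' z \<bullet> f' z = 0) \<or> (\<forall>z. f z \<bullet> f z - g' z \<bullet> g' z = 0)"
  proof (rule quadratic_forms_mult_eq_0)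
    show "f (z + t *\<^sub>R w) \<bullet> f (z + t *\<^sub>R w) - f' (z + t *\<^sub>R w) \<bullet> f' (z + t *\<^sub>R w) =
      f z \<bullet> f z - f' z \<bullet> f' z + t * (2 * (f z \<bullet> f w) - 2 * (f' z \<bullet> f' w)) + t\<^sup>2 * (f w \<bullet> f w - f' w \<bullet> f' w)"
      for z w t
      unfolding inner_self_line_expand[OF lin(1)] inner_self_line_expand[OF lin(3)]
      by (simp add: algebra_simps)
    show "f (z + t *\<^sub>R w) \<bullet> f (z + t *\<^sub>R w) - g' (z + t *\<^sub>R w) \<bullet> g' (z + t *\<^sub>R w) =
      f z \<bullet> f z - g' z \<bullet> g' z + t * (2 * (f z \<bullet> f w) - 2 * (g' z \<bullet> g' w)) + t\<^sup>2 * (f w \<bullet> f w - g' w \<bullet> g' w)"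
      for z w t
      unfolding inner_self_line_expand[OF lin(1)] inner_self_line_expand[OF lin(4)]
      by (simp add: algebra_simps)
    fix z
    define A B C D where "A = f z \<bullet> f z" and "B = g z \<bullet> g z" and "C = f' z \<bullet> f' z" and "D = g' z \<bullet> g' z"
    have "B = C + D - A" "A * B = C * D"
      using s[of z] m[of z] by (simp_all add: A_def B_def C_def D_def)
    then have "(A - C) * (A - D) = 0" by algebra
    then show "f z \<bullet> f z - f' z \<bullet> f' z = 0 \<or> f z \<bullet> f z - g' z \<bullet> g' z = 0"
      by (simp add: A_def C_def D_def)
  qed
  then show ?thesis
  proof
    assume "\<forall>z. f z \<bullet> f z - f' z \<bullet> f' z = 0"
    then have "f z \<bullet> f z = f' z \<bullet> f' z" for z by simp
    then show ?thesis using s by auto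
  next
    assume "\<forall>z. f z \<bullet> f z - g' z \<bullet> g' z = 0"
    then have e: "f z \<bullet> f z = g' z \<bullet> g' z" for z by simp
    have "g z \<bullet> g z = f' z \<bullet> f' z" for z using s[of z] e[of z] by simp
    then show ?thesis using e by blast
  qed
qed

lemma inner_eq_if_norms_eq:
  assumes lin: "linear f" "linear g" and eq: "\<And>z. f z \<bullet> f z = g z \<bullet> g z"
  shows "f z \<bullet> f w = g z \<bullet> g w"
  using eq[of "z + w"] eq[of z] eq[of w]
  by (simp add: linear_add[OF lin(1)] linear_add[OF lin(2)] inner_add_left inner_add_right
      inner_commute[of "f w" "f z"] inner_commute[of "g w" "g z"])

text \<open>By polarisation, both Gram matrices on R^6 are conjugated by the same orthogonal matrix.
  All entries of \<open>inv5\<close> are functions of traces of these matrices and of their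
  products, since the trace of the square of a Gram matrix is 2(m^2 + r^2).\<close>

lemma inv5_eq_if_norms_eq:
  assumes Q: "orthogonal_transformation Q"
    and A: "\<And>z. plane_map x y z \<bullet> plane_map x y z = plane_map x' y' (Q z) \<bullet> plane_map x' y' (Q z)"
    and B: "\<And>z. plane_map p q z \<bullet> plane_map p q z = plane_map p' q' (Q z) \<bullet> plane_map p' q' (Q z)"
  shows "inv5 x y p q = inv5 x' y' p' q'"
proof -
  define G where "G x y = form_matrix (\<lambda>u v. plane_map x y u \<bullet> plane_map x y v)" for x y
  define R where "R = matrix Q"
  have R: "orthogonal_matrix R" and linQ: "linear Q"
    using Q by (simp_all add: R_def orthogonal_transformation_matrix)
  have bil: "bilinear (\<lambda>u v. plane_map x y u \<bullet> plane_map x y v)" for x y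
    by (auto simp: bilinear_def linear_add[OF linear_plane_map] linear_cmul[OF linear_plane_map]
        inner_add_left inner_add_right intro!: linearI)
  have lin: "linear (\<lambda>z. plane_map x y (Q z))" for x y
    using linear_compose[OF linQ linear_plane_map] by (simp add: o_def)
  have G: "G x y = transpose R ** G x' y' ** R"
    if "\<And>z. plane_map x y z \<bullet> plane_map x y z = plane_map x' y' (Q z) \<bullet> plane_map x' y' (Q z)" for x y x' y'
  proof -
    have "G x y = form_matrix (\<lambda>u v. plane_map x' y' (Q u) \<bullet> plane_map x' y' (Q v))"
      unfolding G_def using inner_eq_if_norms_eq[OF linear_plane_map lin that] by simp
    also have "\<dots> = transpose R ** G x' y' ** R"
      unfolding G_def R_def by (rule form_matrix_transform[OF bil])
    finally show ?thesis .
  qed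
  note GA = G[OF A] and GB = G[OF B]
  have tr: "trace (G x y) = x \<bullet> x + y \<bullet> y" for x y
    by (simp add: G_def trace_def form_matrix_def sum_6 plane_map_def axis_def)
  have tr2: "trace (G x y ** G p q) = (x \<bullet> x) * (p \<bullet> p) + 2 * ((x \<bullet> y) * (p \<bullet> q)) + (y \<bullet> y) * (q \<bullet> q)" for x y p q
    by (simp add: G_def trace_def form_matrix_def sum_6 plane_map_def axis_def matrix_matrix_mult_def
        inner_commute)
  have inv: "inv5 x y p q = (let m = trace (G x y) / 2; n = trace (G p q) / 2;
      r = sqrt (trace (G x y ** G x y) / 2 - m\<^sup>2); s = sqrt (trace (G p q ** G p q) / 2 - n\<^sup>2)
      in (m - r, m + r, n - s, n + s, trace (G x y ** G p q)))" for x y p q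
  proof -
    have "gram_r x y = sqrt (trace (G x y ** G x y) / 2 - (trace (G x y) / 2)\<^sup>2)" for x y
      unfolding gram_r_def tr tr2
      by (rule arg_cong[of _ _ sqrt]) (simp add: gram_u_def power2_eq_square field_simps)
    then show ?thesis
      unfolding inv5_def Let_def by (simp add: gram_m_def tr) (simp add: tr2 gram_u_def field_simps)
  qed
  show ?thesis
    unfolding inv GA GB by (simp add: orthogonal_conj_mult[OF R] trace_orthogonal_conj[OF R])
qed

lemma inv5_swap: "inv5 p q x y = swap_pm (inv5 x y p q)"
  by (simp add: inv5_def algebra_simps)

lemma inv5_eq_if_jclass_eq:
  assumes "jclass x y p q = jclass x' y' p' q'"
  shows "inv5 x' y' p' q' = inv5 x y p q \<or> inv5 x' y' p' q' = swap_pm (inv5 x y p q)"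
proof -
  have "(bracket_of (jmap x y p q), bracket_of (jmap x' y' p' q')) \<in> O6_rel"
    using assms unfolding jclass_def
    by (simp add: bracket_class_eq_iff bracket_of_in_N6_hat jmap_in_Hom)
  then obtain Q where Q: "orthogonal_transformation Q"
    and eq: "\<And>u v. br (bracket_of (jmap x' y' p' q')) (Q u) (Q v) = Q (br (bracket_of (jmap x y p q)) u v)"
    by (auto simp: O6_rel_def)
  have linQ: "linear Q" using Q by (simp add: orthogonal_transformation_def)
  have lin: "linear (\<lambda>z. plane_map x y (Q z))" for x y
    using linear_compose[OF linQ linear_plane_map] by (simp add: o_def)
  consider "\<And>z. plane_map x y z \<bullet> plane_map x y z = plane_map x' y' (Q z) \<bullet> plane_map x' y' (Q z)"
      "\<And>z. plane_map p q z \<bullet> plane_map p q z = plane_map p' q' (Q z) \<bullet> plane_map p' q' (Q z)"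
    | "\<And>z. plane_map x y z \<bullet> plane_map x y z = plane_map p' q' (Q z) \<bullet> plane_map p' q' (Q z)"
      "\<And>z. plane_map p q z \<bullet> plane_map p q z = plane_map x' y' (Q z) \<bullet> plane_map x' y' (Q z)"
    using norms_eq_up_to_swap[OF linear_plane_map linear_plane_map lin lin,
        OF plane_map_norms_invariant[OF Q eq]] by blast
  then show ?thesis
  proof cases
    case 1
    then show ?thesis using inv5_eq_if_norms_eq[OF Q 1] by simp
  next
    case 2
    then show ?thesis using inv5_eq_if_norms_eq[OF Q 2] inv5_swap by metis
  qed
qed

lemma jclass_eq_iff:
  "jclass x y p q = jclass x' y' p' q' \<longleftrightarrow>
     inv5 x' y' p' q' = inv5 x y p q \<or> inv5 x' y' p' q' = swap_pm (inv5 x y p q)"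
proof
  assume "inv5 x' y' p' q' = inv5 x y p q \<or> inv5 x' y' p' q' = swap_pm (inv5 x y p q)"
  then show "jclass x y p q = jclass x' y' p' q'"
  proof
    assume "inv5 x' y' p' q' = swap_pm (inv5 x y p q)"
    also have "\<dots> = inv5 p q x y"
      by (rule inv5_swap[symmetric])
    also have "\<dots> = inv5 (flip3 p) (flip3 q) (flip3 x) (flip3 y)"
      by (simp add: inv5_def gram_m_def gram_u_def gram_r_def)
    finally have "jclass x' y' p' q' = jclass (flip3 p) (flip3 q) (flip3 x) (flip3 y)"
      by (rule jclass_eq_if_inv5_eq)
    then show ?thesis by (simp add: jclass_swap)
  next
    assume "inv5 x' y' p' q' = inv5 x y p q"
    then show ?thesis by (rule jclass_eq_if_inv5_eq[symmetric])
  qed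
qed (rule inv5_eq_if_jclass_eq)

section \<open>The two quotient maps\<close>

text \<open>Grouped in pairs so that \<open>prod.swap\<close> exchanges the minus and the plus
  component.\<close>

type_synonym params = "((real^3) \<times> (real^3)) \<times> ((real^3) \<times> (real^3))"

definition jpar :: "params \<Rightarrow> real^2 \<Rightarrow> real^4^4" where
  "jpar w = jmap (fst (fst w)) (snd (fst w)) (fst (snd w)) (snd (snd w))"

definition cpar :: "params \<Rightarrow> bilin6 set" where
  "cpar w = bracket_class (bracket_of (jpar w))"

definition ipar :: "params \<Rightarrow> real5" where
  "ipar w = inv5 (fst (fst w)) (snd (fst w)) (fst (snd w)) (snd (snd w))"

lemma jpar_in_Hom: "jpar w \<in> Hom_R2_so4"
  by (simp add: jpar_def jmap_in_Hom)

lemma Hom_R2_so4_eq_range: "Hom_R2_so4 = range jpar"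
proof
  show "Hom_R2_so4 \<subseteq> range jpar"
  proof
    fix j assume "j \<in> Hom_R2_so4"
    then obtain x y p q where "j = jmap x y p q" by (rule Hom_R2_so4_jmapE)
    then have "j = jpar ((x, y), (p, q))" by (simp add: jpar_def)
    then show "j \<in> range jpar" by blast
  qed
qed (auto simp: jpar_in_Hom)

lemma invariants_jpar: "invariants (jpar w) = ipar w"
  by (simp add: jpar_def ipar_def invariants_jmap)

lemma ipar_in_S_hat: "ipar w \<in> S_hat"
  by (simp add: ipar_def inv5_in_S_hat)

lemma ipar_swap: "ipar (prod.swap w) = swap_pm (ipar w)"
  unfolding ipar_def fst_swap snd_swap by (rule inv5_swap)

lemma swap_pm_swap_pm [simp]: "swap_pm (swap_pm s) = s"
  by (cases s) simp

lemma swap_pm_in_S_hat: "s \<in> S_hat \<Longrightarrow> swap_pm s \<in> S_hat"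
  by (cases s) (auto simp: S_hat_def algebra_simps)

lemma S_class_eq_iff:
  assumes "s \<in> S_hat" "s' \<in> S_hat"
  shows "S_class s = S_class s' \<longleftrightarrow> s' = s \<or> s' = swap_pm s"
proof -
  have cl: "S_class r = {r, swap_pm r}" if "r \<in> S_hat" for r
    using that swap_pm_in_S_hat[OF that] unfolding S_class_def S_rel_def by blast
  show ?thesis
    unfolding cl[OF assms(1)] cl[OF assms(2)] doubleton_eq_iff by auto
qed

text \<open>The two maps from the parameter space have the same fibres; this makes
  \<open>Psi\<close> well defined and injective.\<close>

lemma cpar_eq_iff: "cpar w = cpar w' \<longleftrightarrow> S_class (ipar w) = S_class (ipar w')"
  unfolding S_class_eq_iff[OF ipar_in_S_hat ipar_in_S_hat]
  unfolding cpar_def jpar_def ipar_def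
  by (rule jclass_eq_iff[unfolded jclass_def])

lemma linear_bracket_of_jpar: "linear (\<lambda>w. bracket_of (jpar w))"
  by (rule linearI; rule blinfun_eqI; rule blinfun_eqI)
    (simp_all add: bracket_of_apply blinfun.add_left blinfun.scaleR_left jpar_def jmap_def vec_eq_iff
      forall_6 inner_vec_def matrix_vector_mult_def sum_4 algebra_simps)

lemma br_jmap_nth:
  "br (bracket_of (jmap x y p q)) u v $ 5 = proj4 u \<bullet> (so4_of x p *v proj4 v)"
  "br (bracket_of (jmap x y p q)) u v $ 6 = proj4 u \<bullet> (so4_of y q *v proj4 v)"
  unfolding bracket_of_apply by (simp_all add: jmap_def) (simp_all add: axis_def)

lemma closedin_sequentialI:
  fixes S T :: "'a::first_countable_topology set"
  assumes "T \<subseteq> S" and lim: "\<And>x l. (\<And>n. x n \<in> T) \<Longrightarrow> l \<in> S \<Longrightarrow> x \<longlonglongrightarrow> l \<Longrightarrow> l \<in> T"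
  shows "closedin (top_of_set S) T"
proof -
  have "T = S \<inter> closure T"
  proof
    show "T \<subseteq> S \<inter> closure T" using assms(1) closure_subset by blast
    show "S \<inter> closure T \<subseteq> T"
    proof
      fix l assume "l \<in> S \<inter> closure T"
      then have "l \<in> S" "l \<in> closure T" by auto
      then obtain x where "\<And>n. x n \<in> T" "x \<longlonglongrightarrow> l" "l \<in> S"
        unfolding closure_sequential by blast
      then show "l \<in> T" using lim by blast
    qed
  qed
  then show ?thesis unfolding closedin_closed by blast
qed

section \<open>The map from parameters to classes of brackets\<close>

lemma continuous_map_cpar: "continuous_map euclidean N6 cpar"
proof -
  have "continuous_on UNIV (\<lambda>w. bracket_of (jpar w))"
    using linear_bracket_of_jpar by (simp add: linear_continuous_on linear_conv_bounded_linear)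
  then have "continuous_map euclidean (top_of_set N6_hat) (\<lambda>w. bracket_of (jpar w))"
    by (auto simp: continuous_map_in_subtopology bracket_of_in_N6_hat jpar_in_Hom)
  then have "continuous_map euclidean N6 (bracket_class \<circ> (\<lambda>w. bracket_of (jpar w)))"
    using quotient_imp_continuous_map[OF quotient_map_quotient_topology[of "top_of_set N6_hat" O6_rel]]
    unfolding N6_def bracket_class_def[abs_def] by (rule continuous_map_compose)
  then show ?thesis by (simp add: cpar_def[abs_def] o_def)
qed

text \<open>Brackets of basis vectors have as entries the sums and, up to sign, the differences of
  corresponding coordinates of the two components, so a bound on the bracket bounds every
  coordinate. The factor 12 counts three coordinates for each of four vectors.\<close>

lemma norm_jpar_bound:
  assumes B: "\<And>u v. norm (br (bracket_of (jpar w)) u v) \<le> B * norm u * norm v"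
  shows "norm w \<le> 12 * B"
proof -
  obtain x y p q where w: "w = ((x, y), (p, q))" by (metis prod.exhaust)
  have e: "\<bar>br (bracket_of (jpar w)) (axis a 1) (axis b 1) $ k\<bar> \<le> B" for a b k
  proof -
    have "norm (br (bracket_of (jpar w)) (axis a 1) (axis b 1)) \<le> B"
      using B[of "axis a 1" "axis b 1"] unfolding norm_axis_1 by simp
    then show ?thesis by (rule order_trans[OF component_le_norm_cart])
  qed
  have half: "\<bar>a\<bar> \<le> B \<and> \<bar>b\<bar> \<le> B" if "\<bar>a + b\<bar> \<le> B" "\<bar>a - b\<bar> \<le> B \<or> \<bar>b - a\<bar> \<le> B" for a b :: real
    using that by linarith
  have norm3: "norm a \<le> 3 * B" if "\<forall>i. \<bar>a $ i\<bar> \<le> B" for a :: "real^3"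
  proof -
    have "norm a \<le> (\<Sum>i\<in>UNIV. \<bar>a $ i\<bar>)" by (rule norm_le_l1_cart)
    also have "\<dots> \<le> 3 * B"
      using sum_bounded_above[of UNIV "\<lambda>i. \<bar>a $ i\<bar>" B] that by simp
    finally show ?thesis .
  qed
  note entry = w jpar_def fst_conv snd_conv br_jmap_nth proj4_axis matrix_entry so4_of_nth
  have "\<bar>x $ 1 + p $ 1\<bar> \<le> B" "\<bar>x $ 2 + p $ 2\<bar> \<le> B" "\<bar>x $ 3 + p $ 3\<bar> \<le> B"
    "\<bar>p $ 1 - x $ 1\<bar> \<le> B" "\<bar>x $ 2 - p $ 2\<bar> \<le> B" "\<bar>p $ 3 - x $ 3\<bar> \<le> B"
    using e[of 1 2 5] e[of 1 3 5] e[of 1 4 5] e[of 3 4 5] e[of 2 4 5] e[of 2 3 5]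
    unfolding entry by - assumption+
  then have "\<forall>i. \<bar>x $ i\<bar> \<le> B \<and> \<bar>p $ i\<bar> \<le> B"
    unfolding forall_3 using half by blast
  then have xp: "norm x \<le> 3 * B" "norm p \<le> 3 * B"
    by (simp_all add: norm3)
  have "\<bar>y $ 1 + q $ 1\<bar> \<le> B" "\<bar>y $ 2 + q $ 2\<bar> \<le> B" "\<bar>y $ 3 + q $ 3\<bar> \<le> B"
    "\<bar>q $ 1 - y $ 1\<bar> \<le> B" "\<bar>y $ 2 - q $ 2\<bar> \<le> B" "\<bar>q $ 3 - y $ 3\<bar> \<le> B"
    using e[of 1 2 6] e[of 1 3 6] e[of 1 4 6] e[of 3 4 6] e[of 2 4 6] e[of 2 3 6]
    unfolding entry by - assumption+
  then have "\<forall>i. \<bar>y $ i\<bar> \<le> B \<and> \<bar>q $ i\<bar> \<le> B"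
    unfolding forall_3 using half by blast
  then have yq: "norm y \<le> 3 * B" "norm q \<le> 3 * B"
    by (simp_all add: norm3)
  have "norm w \<le> norm (x, y) + norm (p, q)"
    unfolding w by (rule norm_Pair_le)
  also have "\<dots> \<le> (norm x + norm y) + (norm p + norm q)"
    by (intro add_mono norm_Pair_le)
  finally show ?thesis using xp yq by linarith
qed

text \<open>\<open>O(6)\<close> is compact and the bracket bounds the parameters, so limits of representatives exist.\<close>

lemma closed_map_cpar: "closed_map euclidean N6 cpar"
  unfolding closed_map_def
proof (intro allI impI)
  fix K :: "params set" assume "closedin euclidean K"
  then have K: "closed K" by simp
  have sub: "cpar ` K \<subseteq> topspace N6"
    using continuous_map_cpar by (auto simp: continuous_map_def Pi_iff)
  \<comment> \<open>Closedness in the quotient is tested on the preimage in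
    \<open>N6_hat\<close>.\<close>
  have "closedin (top_of_set N6_hat) {c \<in> N6_hat. bracket_class c \<in> cpar ` K}"
  proof (rule closedin_sequentialI)
    fix c l assume "\<And>n::nat. c n \<in> {c \<in> N6_hat. bracket_class c \<in> cpar ` K}"
      and l: "l \<in> N6_hat" "c \<longlonglongrightarrow> l"
    then have c: "\<And>n. c n \<in> N6_hat" "\<And>n. bracket_class (c n) \<in> cpar ` K"
      by auto
    have "\<exists>w Q. w \<in> K \<and> orthogonal_transformation Q \<and>
        (\<forall>u v. br (c n) (Q u) (Q v) = Q (br (bracket_of (jpar w)) u v))" for n
    proof -
      obtain w where w: "w \<in> K" "bracket_class (bracket_of (jpar w)) = bracket_class (c n)"
        using c(2)[of n] by (auto simp: cpar_def)
      then have "(bracket_of (jpar w), c n) \<in> O6_rel"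
        by (simp add: bracket_class_eq_iff c bracket_of_in_N6_hat jpar_in_Hom)
      then show ?thesis using w(1) unfolding O6_rel_def by blast
    qed
    then obtain w Q where w: "\<And>n. w n \<in> K" and Q: "\<And>n. orthogonal_transformation (Q n)"
      and eq: "\<And>n u v. br (c n) (Q n u) (Q n v) = Q n (br (bracket_of (jpar (w n))) u v)"
      by metis
    \<comment> \<open>As elements of a finite-dimensional normed space the isometries have
      convergent subsequences, taken jointly with those of the parameters.\<close>
    define P where "P n = Blinfun (Q n)" for n
    have "bounded_linear (Q n)" for n
      using Q[of n] by (simp add: orthogonal_transformation_def linear_conv_bounded_linear)
    then have P: "blinfun_apply (P n) = Q n" for n
      unfolding P_def by (rule bounded_linear_Blinfun_apply)
    have normQ: "norm (Q n u) = norm u" for n u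
      using Q[of n] by (simp add: orthogonal_transformation)
    have normP: "norm (P n) \<le> 1" for n
      by (rule norm_blinfun_bound) (simp_all add: P normQ)
    obtain B where B: "\<And>n. norm (c n) \<le> B"
      using Bseq_def convergent_imp_Bseq convergentI[OF l(2)] by metis
    have "norm (br (bracket_of (jpar (w n))) u v) \<le> B * norm u * norm v" for n u v
    proof -
      have "norm (br (bracket_of (jpar (w n))) u v) = norm (br (c n) (Q n u) (Q n v))"
        by (simp add: eq normQ)
      also have "\<dots> \<le> norm (blinfun_apply (c n) (Q n u)) * norm (Q n v)"
        by (rule norm_blinfun)
      also have "\<dots> \<le> (norm (c n) * norm (Q n u)) * norm (Q n v)"
        by (intro mult_right_mono norm_blinfun norm_ge_zero)
      also have "\<dots> \<le> B * norm u * norm v"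
        unfolding normQ by (intro mult_right_mono B norm_ge_zero)
      finally show ?thesis .
    qed
    then have normw: "norm (w n) \<le> 12 * B" for n
      by (rule norm_jpar_bound)
    have "bounded (range (\<lambda>n. (P n, w n)))"
    proof (rule boundedI)
      fix z assume "z \<in> range (\<lambda>n. (P n, w n))"
      then obtain n where "z = (P n, w n)" by blast
      then have "norm z \<le> norm (P n) + norm (w n)"
        using norm_Pair_le by blast
      then show "norm z \<le> 1 + 12 * B"
        using normP[of n] normw[of n] by linarith
    qed
    then obtain z r where r: "strict_mono (r::nat \<Rightarrow> nat)" "((\<lambda>n. (P n, w n)) \<circ> r) \<longlonglongrightarrow> z"
      using bounded_imp_convergent_subsequence[of "\<lambda>n. (P n, w n)"] by blast
    define P' w' where "P' = fst z" and "w' = snd z"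
    have Pl: "(\<lambda>n. P (r n)) \<longlonglongrightarrow> P'" and wl: "(\<lambda>n. w (r n)) \<longlonglongrightarrow> w'"
      using tendsto_fst[OF r(2)] tendsto_snd[OF r(2)] by (simp_all add: P'_def w'_def o_def)
    have w': "w' \<in> K"
      using closed_sequentially[OF K _ wl] w by blast
    have cl: "(\<lambda>n. c (r n)) \<longlonglongrightarrow> l"
      using LIMSEQ_subseq_LIMSEQ[OF l(2) r(1)] by (simp add: o_def)
    have "(\<lambda>n. bracket_of (jpar (w (r n)))) \<longlonglongrightarrow> bracket_of (jpar w')"
      by (rule bounded_linear.tendsto[OF linear_bracket_of_jpar[unfolded linear_conv_bounded_linear] wl])
    then have lim1: "(\<lambda>n. blinfun_apply (P (r n)) (br (bracket_of (jpar (w (r n)))) u v)) \<longlonglongrightarrow>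
        blinfun_apply P' (br (bracket_of (jpar w')) u v)" for u v
      by (intro blinfun.tendsto Pl tendsto_const)
    have lim2: "(\<lambda>n. br (c (r n)) (blinfun_apply (P (r n)) u) (blinfun_apply (P (r n)) v)) \<longlonglongrightarrow>
        br l (blinfun_apply P' u) (blinfun_apply P' v)" for u v
      by (intro blinfun.tendsto Pl cl tendsto_const)
    have "br l (blinfun_apply P' u) (blinfun_apply P' v) =
        blinfun_apply P' (br (bracket_of (jpar w')) u v)" for u v
      using lim2[of u v] lim1[of u v] unfolding P eq by (rule LIMSEQ_unique)
    moreover have "norm (blinfun_apply P' u) = norm u" for u
    proof -
      have "(\<lambda>n. norm (blinfun_apply (P (r n)) u)) \<longlonglongrightarrow> norm (blinfun_apply P' u)"
        by (intro tendsto_norm blinfun.tendsto Pl tendsto_const)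
      then show ?thesis
        unfolding P normQ by (simp add: LIMSEQ_const_iff)
    qed
    then have "orthogonal_transformation (blinfun_apply P')"
      by (simp add: orthogonal_transformation linear_conv_bounded_linear blinfun.bounded_linear_right)
    ultimately have "(bracket_of (jpar w'), l) \<in> O6_rel"
      using l(1) by (auto simp: O6_rel_def bracket_of_in_N6_hat jpar_in_Hom)
    then have "cpar w' = bracket_class l"
      by (simp add: cpar_def bracket_class_eq_iff l bracket_of_in_N6_hat jpar_in_Hom)
    then have "bracket_class l \<in> cpar ` K"
      using w' by (metis imageI)
    then show "l \<in> {c \<in> N6_hat. bracket_class c \<in> cpar ` K}"
      using l(1) by blast
  qed blast
  moreover have "quotient_map (top_of_set N6_hat) N6 bracket_class"
    unfolding N6_def bracket_class_def[abs_def] by (rule quotient_map_quotient_topology)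
  ultimately show "closedin N6 (cpar ` K)"
    using sub unfolding quotient_map_closedin by (auto simp: topspace_subtopology)
qed

section \<open>The map from parameters to S\<close>

lemma quotient_map_S_class: "quotient_map (top_of_set S_hat) S_space S_class"
  unfolding S_space_def S_class_def[abs_def] by (rule quotient_map_quotient_topology)

lemma continuous_ipar: "continuous_on UNIV ipar"
  unfolding ipar_def[abs_def] inv5_def gram_r_def gram_m_def gram_u_def by (intro continuous_intros) auto

lemma continuous_map_S_class_ipar: "continuous_map euclidean S_space (\<lambda>w. S_class (ipar w))"
proof -
  have "continuous_map euclidean (top_of_set S_hat) ipar"
    using continuous_ipar by (auto simp: continuous_map_in_subtopology ipar_in_S_hat)
  then have "continuous_map euclidean S_space (S_class \<circ> ipar)"
    using quotient_imp_continuous_map[OF quotient_map_S_class] by (rule continuous_map_compose)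
  then show ?thesis by (simp add: o_def)
qed

text \<open>The four eigenvalues add up to the squared norm of the parameters, so convergent
  invariants come from bounded parameters.\<close>

lemma closed_image_ipar:
  assumes K: "closed K" shows "closed (ipar ` K)"
  unfolding closed_sequential_limits
proof (intro allI impI)
  fix s l assume sl: "(\<forall>n::nat. s n \<in> ipar ` K) \<and> s \<longlonglongrightarrow> l"
  then have s: "s \<longlonglongrightarrow> l" and "\<forall>n. \<exists>w. w \<in> K \<and> s n = ipar w"
    by blast+
  from choice[OF this(2)] obtain w where w: "\<And>n. w n \<in> K" "\<And>n. s n = ipar (w n)"
    by blast
  define g :: "real5 \<Rightarrow> real" where "g = (\<lambda>(am, bm, ap, bp, t). am + bm + ap + bp)"
  have g: "g (ipar w) = (norm w)\<^sup>2" for w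
    by (cases w) (auto simp: g_def ipar_def inv5_def gram_m_def norm_Pair dot_square_norm)
  have "(\<lambda>n. g (s n)) \<longlonglongrightarrow> g l"
    unfolding g_def case_prod_beta using s by (intro tendsto_intros)
  then obtain B where B: "\<And>n. norm (g (s n)) \<le> B"
    using Bseq_def convergent_imp_Bseq convergentI by metis
  have "norm (w n) \<le> sqrt B" for n
    using B[of n] by (intro real_le_rsqrt) (simp add: w g)
  then have "bounded (range w)"
    by (intro boundedI) auto
  then obtain w' r where r: "strict_mono (r::nat \<Rightarrow> nat)" "(w \<circ> r) \<longlonglongrightarrow> w'"
    using bounded_imp_convergent_subsequence[of w] by blast
  have "w' \<in> K"
    using closed_sequentially[OF K _ r(2)] w by simp
  have "(\<lambda>n. ipar ((w \<circ> r) n)) \<longlonglongrightarrow> ipar w'"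
    by (rule continuous_on_tendsto_compose[OF continuous_ipar r(2)]) simp_all
  moreover have "(\<lambda>n. ipar ((w \<circ> r) n)) \<longlonglongrightarrow> l"
    using LIMSEQ_subseq_LIMSEQ[OF s r(1)] by (simp add: o_def w)
  ultimately have "l = ipar w'" by (rule LIMSEQ_unique[symmetric])
  then show "l \<in> ipar ` K" using \<open>w' \<in> K\<close> by blast
qed

text \<open>The preimage in \<open>S_hat\<close> of the image of K is the image under
  \<open>ipar\<close> of K together with its swapped copy, which is closed.\<close>

lemma closed_map_S_class_ipar: "closed_map euclidean S_space (\<lambda>w. S_class (ipar w))"
  unfolding closed_map_def
proof (intro allI impI)
  fix K :: "params set" assume "closedin euclidean K"
  then have K: "closed K" by simp
  have "closed (prod.swap -` K)"
    using K by (rule closed_vimage) (intro continuous_on_swap)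
  then have "closed (ipar ` (K \<union> prod.swap -` K))"
    using K by (intro closed_image_ipar closed_Un)
  moreover have "{s \<in> S_hat. S_class s \<in> (\<lambda>w. S_class (ipar w)) ` K} = ipar ` (K \<union> prod.swap -` K)"
  proof
    show "{s \<in> S_hat. S_class s \<in> (\<lambda>w. S_class (ipar w)) ` K} \<subseteq> ipar ` (K \<union> prod.swap -` K)"
    proof
      fix s assume s: "s \<in> {s \<in> S_hat. S_class s \<in> (\<lambda>w. S_class (ipar w)) ` K}"
      then obtain w where w: "w \<in> K" "S_class s = S_class (ipar w)" by blast
      then have "ipar w = s \<or> ipar w = swap_pm s"
        using s by (simp add: S_class_eq_iff ipar_in_S_hat)
      then have "s = ipar w \<or> s = ipar (prod.swap w)"
        by (auto simp: ipar_swap)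
      moreover have "prod.swap w \<in> prod.swap -` K" using w by simp
      ultimately show "s \<in> ipar ` (K \<union> prod.swap -` K)" using w(1) by blast
    qed
    show "ipar ` (K \<union> prod.swap -` K) \<subseteq> {s \<in> S_hat. S_class s \<in> (\<lambda>w. S_class (ipar w)) ` K}"
    proof
      fix s assume "s \<in> ipar ` (K \<union> prod.swap -` K)"
      then obtain w where w: "s = ipar w" "w \<in> K \<or> prod.swap w \<in> K" by auto
      have "S_class (ipar w) = S_class (ipar (prod.swap w))"
        by (simp add: S_class_eq_iff ipar_in_S_hat) (simp add: ipar_swap)
      then show "s \<in> {s \<in> S_hat. S_class s \<in> (\<lambda>w. S_class (ipar w)) ` K}"
        using w ipar_in_S_hat by auto
    qed
  qed
  ultimately have "closedin (top_of_set S_hat) {s \<in> S_hat. S_class s \<in> (\<lambda>w. S_class (ipar w)) ` K}"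
    by (intro closed_subset) auto
  moreover have "(\<lambda>w. S_class (ipar w)) ` K \<subseteq> topspace S_space"
    using continuous_map_S_class_ipar by (auto simp: continuous_map_def Pi_iff)
  ultimately show "closedin S_space ((\<lambda>w. S_class (ipar w)) ` K)"
    using quotient_map_S_class unfolding quotient_map_closedin by (auto simp: topspace_subtopology)
qed

text \<open>Cholesky factorisation of a positive semidefinite matrix; for a = 0 the hypothesis
  forces b = 0.\<close>

lemma ex_gram:
  assumes "0 \<le> a" "0 \<le> d" "b\<^sup>2 \<le> a * d"
  shows "\<exists>x y :: real^3. x \<bullet> x = a \<and> x \<bullet> y = b \<and> y \<bullet> y = d"
proof (cases "a = 0")
  case True
  then show ?thesis
    using assms by (intro exI[of _ 0] exI[of _ "vector [sqrt d, 0, 0]"]) (simp add: inner_3)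
next
  case False
  then have "b\<^sup>2 / a \<le> d" using assms by (simp add: divide_le_eq mult.commute)
  then show ?thesis
    using assms False
    by (intro exI[of _ "vector [sqrt a, 0, 0]"] exI[of _ "vector [b / sqrt a, sqrt (d - b\<^sup>2 / a), 0]"])
      (simp add: inner_3 power2_eq_square)
qed

text \<open>The matrix with diagonal m + u, m - u and off-diagonal entry sqrt(r^2 - u^2) has
  determinant m^2 - r^2, so \<open>ex_gram\<close> applies.\<close>

lemma ex_gram_mru:
  assumes "\<bar>u\<bar> \<le> r" "r \<le> m"
  shows "\<exists>x y :: real^3. gram_m x y = m \<and> gram_r x y = r \<and> gram_u x y = u \<and> x \<bullet> y = sqrt (r\<^sup>2 - u\<^sup>2)"
proof -
  have "u\<^sup>2 \<le> r\<^sup>2" using assms by (simp add: abs_le_square_iff[symmetric])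
  moreover have "r\<^sup>2 \<le> m\<^sup>2" using assms by (intro power_mono) auto
  ultimately have "(sqrt (r\<^sup>2 - u\<^sup>2))\<^sup>2 \<le> (m + u) * (m - u)"
    by (simp add: power2_eq_square algebra_simps)
  moreover have "0 \<le> m + u" "0 \<le> m - u"
    using assms by linarith+
  ultimately obtain x y :: "real^3" where xy: "x \<bullet> x = m + u" "x \<bullet> y = sqrt (r\<^sup>2 - u\<^sup>2)" "y \<bullet> y = m - u"
    using ex_gram by blast
  have "gram_r x y = r"
    using xy \<open>u\<^sup>2 \<le> r\<^sup>2\<close> assms by (simp add: gram_r_def gram_u_def)
  then show ?thesis
    using xy by (intro exI[of _ x] exI[of _ y]) (simp add: gram_m_def gram_u_def)
qed

lemma ipar_surj: "S_hat \<subseteq> range ipar"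
proof
  fix s assume "s \<in> S_hat"
  then obtain am bm ap bp t where s: "s = (am, bm, ap, bp, t)" "0 \<le> am" "am \<le> bm" "0 \<le> ap" "ap \<le> bp"
    "am * bp + ap * bm \<le> t" "t \<le> am * ap + bm * bp"
    by (auto simp: S_hat_def)
  \<comment> \<open>Means and radii of the two eigenvalue pairs; \<open>d\<close> is the inner
    product that the two traceless parts must have.\<close>
  define m r n s' d where "m = (am + bm) / 2" and "r = (bm - am) / 2" and "n = (ap + bp) / 2"
    and "s' = (bp - ap) / 2" and "d = t / 2 - m * n"
  have sum: "m * n + r * s' = (am * ap + bm * bp) / 2" "m * n - r * s' = (am * bp + ap * bm) / 2"
    by (simp_all add: m_def r_def n_def s'_def field_simps)
  have "t / 2 \<le> m * n + r * s'" "m * n - r * s' \<le> t / 2"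
    unfolding sum using s by simp_all
  then have d: "\<bar>d\<bar> \<le> r * s'"
    unfolding d_def abs_le_iff by simp
  have nn: "0 \<le> r" "r \<le> m" "0 \<le> s'" "s' \<le> n"
    using s by (simp_all add: m_def r_def n_def s'_def)
  \<comment> \<open>The first traceless part will be (r, 0), so the second must have first
    coordinate d / r. For r = 0 the bound forces d = 0, and 0 serves.\<close>
  obtain u where u: "\<bar>u\<bar> \<le> s'" "r * u = d"
  proof (cases "r = 0")
    case True
    then show thesis using d nn that[of 0] by simp
  next
    case False
    then have "\<bar>d / r\<bar> \<le> s'" using d nn by (simp add: abs_divide divide_le_eq mult.commute)
    then show thesis using that[of "d / r"] False by simp
  qed
  obtain x y :: "real^3" where xy: "gram_m x y = m" "gram_r x y = r" "gram_u x y = r" "x \<bullet> y = sqrt (r\<^sup>2 - r\<^sup>2)"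
    using ex_gram_mru[of r r m] nn by auto
  obtain p q :: "real^3" where pq: "gram_m p q = n" "gram_r p q = s'" "gram_u p q = u"
    using ex_gram_mru[of u s' n] nn u by auto
  have "ipar ((x, y), (p, q)) = (m - r, m + r, n - s', n + s', 2 * (m * n + r * u))"
    by (simp add: ipar_def inv5_def xy pq)
  also have "\<dots> = s"
    unfolding u(2) s(1) by (simp add: d_def) (simp add: m_def r_def n_def s'_def field_simps)
  finally show "s \<in> range ipar" by (metis rangeI)
qed

lemma quotient_map_S_class_ipar: "quotient_map euclidean S_space (\<lambda>w. S_class (ipar w))"
proof (rule continuous_closed_imp_quotient_map[OF continuous_map_S_class_ipar closed_map_S_class_ipar])
  have "range ipar = S_hat" using ipar_surj ipar_in_S_hat by auto
  then have "range (\<lambda>w. S_class (ipar w)) = S_class ` S_hat" by (simp flip: image_image)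
  then show "(\<lambda>w. S_class (ipar w)) ` topspace euclidean = topspace S_space"
    using quotient_imp_surjective_map[OF quotient_map_S_class] by simp
qed

section \<open>The closure of the classes with two-dimensional commutator ideal\<close>

text \<open>The Householder reflection along u - e. That it fixes vectors orthogonal to both u and e
  allows a second one to follow without disturbing the first.\<close>

lemma ex_reflection:
  fixes u e :: "'a::euclidean_space"
  assumes "norm u = norm e"
  shows "\<exists>H. orthogonal_transformation H \<and> H u = e \<and> (\<forall>x. x \<bullet> u = 0 \<and> x \<bullet> e = 0 \<longrightarrow> H x = x)"
proof (cases "u = e")
  case True
  then show ?thesis by (intro exI[of _ "\<lambda>x. x"]) (simp add: orthogonal_transformation_id)
next
  case False
  define a where "a = u - e"
  define H where "H x = x - (2 * (x \<bullet> a) / (a \<bullet> a)) *\<^sub>R a" for x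
  have a: "a \<bullet> a \<noteq> 0" using False by (simp add: a_def)
  have ue: "u \<bullet> u = e \<bullet> e" using assms by (simp add: norm_eq)
  have lin: "linear H"
    by (rule linearI) (simp_all add: H_def inner_add_left algebra_simps add_divide_distrib)
  have "H x \<bullet> H y = x \<bullet> y" for x y
    using a by (simp add: H_def inner_diff_left inner_diff_right inner_commute[of a y] field_simps)
  then have "orthogonal_transformation H"
    using lin by (simp add: orthogonal_transformation_def)
  moreover have "2 * (u \<bullet> a) = a \<bullet> a"
    by (simp add: a_def inner_diff_left inner_diff_right inner_commute[of e u] ue)
  then have "H u = e" using a by (simp add: H_def) (simp add: a_def)
  moreover have "H x = x" if "x \<bullet> u = 0" "x \<bullet> e = 0" for x
    using that by (simp add: H_def a_def inner_diff_right)
  ultimately show ?thesis by blast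
qed

text \<open>After the first reflection, e is orthogonal to the image of v and to f, so the
  reflection between these two fixes e.\<close>

lemma ex_orthogonal_pair:
  fixes u v e f :: "'a::euclidean_space"
  assumes "norm u = norm e" "norm v = norm f" "u \<bullet> v = 0" "e \<bullet> f = 0"
  shows "\<exists>Q. orthogonal_transformation Q \<and> Q u = e \<and> Q v = f"
proof -
  obtain H where H: "orthogonal_transformation H" "H u = e"
    using ex_reflection[OF assms(1)] by blast
  have "norm (H v) = norm f"
    using H(1) assms(2) by (simp add: orthogonal_transformation)
  then obtain H' where H': "orthogonal_transformation H'" "H' (H v) = f"
      "\<And>x. x \<bullet> H v = 0 \<Longrightarrow> x \<bullet> f = 0 \<Longrightarrow> H' x = x"
    using ex_reflection[of "H v" f] by blast
  have "e \<bullet> H v = 0"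
    using H assms(3) by (metis orthogonal_transformation_def)
  then have "H' e = e" using H'(3) assms(4) by blast
  then show ?thesis
    using H H' orthogonal_transformation_compose[OF H'(1) H(1)]
    by (intro exI[of _ "H' \<circ> H"]) simp
qed

lemma norm_axis_orth: "norm (axis 5 1 :: real^6) = 1" "norm (axis 6 1 :: real^6) = 1"
  "(axis 5 1 :: real^6) \<bullet> axis 6 1 = 0"
  by (simp_all add: inner_axis_axis)

lemma incl4_incl2_split: "u = incl4 (proj4 u) + incl2 (proj2 u)"
  by (simp add: vec_eq_iff forall_6)

lemma linear_incl4: "linear incl4"
  by (rule linearI) (simp_all add: vec_eq_iff forall_6)

text \<open>An isometry moves an orthonormal basis of the commutator ideal to axes 5 and 6. The
  transported bracket \<open>d\<close> has values in their span and vanishes on it, because the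
  commutator ideal is central; so it comes from a bracket on R^4.\<close>

lemma N62_subset_range_cpar: "N62 \<subseteq> range cpar"
proof
  fix C assume "C \<in> N62"
  then obtain c where C: "C = bracket_class c" and c: "c \<in> N6_hat" and dim: "dim (commutator_ideal c) = 2"
    by (auto simp: N62_def)
  have skew: "br c u v = - br c v u" for u v
  proof -
    have "br c (u + v) (u + v) = 0" "br c u u = 0" "br c v v = 0"
      using c by (simp_all add: N6_hat_def)
    then show ?thesis
      by (simp add: blinfun.add_left blinfun.add_right eq_neg_iff_add_eq_0 add.commute)
  qed
  define W where "W = commutator_ideal c"
  have sub: "subspace W" by (simp add: W_def commutator_ideal_def)
  have brW: "br c u v \<in> W" for u v
    unfolding W_def commutator_ideal_def by (rule span_base) blast
  have central: "br c w v = 0" if "w \<in> W" for w v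
    using that unfolding W_def commutator_ideal_def
  proof (induction rule: span_induct_alt)
    case base
    then show ?case by (simp add: blinfun.zero_left)
  next
    case (step a x y)
    then show ?case
      using c by (auto simp: N6_hat_def blinfun.add_left blinfun.scaleR_left blinfun.add_right
          blinfun.scaleR_right)
  qed
  obtain B where B: "B \<subseteq> W" "pairwise orthogonal B" "\<And>x. x \<in> B \<Longrightarrow> norm x = 1"
      "card B = dim W" "span B = W"
    using orthonormal_basis_subspace[OF sub] by metis
  then have "card B = 2" using dim by (simp add: W_def)
  then obtain u0 v0 where uv: "B = {u0, v0}" "u0 \<noteq> v0"
    by (auto simp: card_2_iff)
  have "u0 \<bullet> v0 = 0" using B(2) uv by (simp add: pairwise_def orthogonal_def)
  moreover have "norm u0 = 1" "norm v0 = 1" using B(3) uv by simp_all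
  ultimately obtain Q :: "real^6 \<Rightarrow> real^6" where Q: "orthogonal_transformation Q" "Q u0 = axis 5 1" "Q v0 = axis 6 1"
    using ex_orthogonal_pair[of u0 "axis 5 1" v0 "axis 6 1"] norm_axis_orth by auto
  have linQ: "linear Q" using Q(1) by (simp add: orthogonal_transformation_def)
  define P where "P = inv Q"
  have QP: "Q (P a) = a" "P (Q a) = a" for a
    using orthogonal_transformation_surj[OF Q(1)] orthogonal_transformation_inj[OF Q(1)]
    by (simp_all add: P_def surj_f_inv_f)
  have "orthogonal_transformation P"
    unfolding P_def by (rule orthogonal_transformation_inv[OF Q(1)])
  then have linP: "linear P" by (simp add: orthogonal_transformation_def)
  have W: "w \<in> W \<longleftrightarrow> (\<exists>a b. w = a *\<^sub>R u0 + b *\<^sub>R v0)" for w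
  proof -
    have "w \<in> W \<longleftrightarrow> (\<exists>a b. w - a *\<^sub>R u0 = b *\<^sub>R v0)"
      unfolding B(5)[symmetric] uv(1) span_breakdown_eq[of w u0] span_singleton by blast
    then show ?thesis by (simp add: diff_eq_eq add.commute)
  qed
  define d where "d u v = Q (br c (P u) (P v))" for u v
  have dQ: "d (Q u) (Q v) = Q (br c u v)" for u v
    by (simp add: d_def QP)
  have d_incl2: "\<exists>z. d u v = incl2 z" for u v
  proof -
    obtain a b where "br c (P u) (P v) = a *\<^sub>R u0 + b *\<^sub>R v0"
      using brW W by blast
    then have "d u v = incl2 (vector [a, b])"
      by (simp add: d_def linear_add[OF linQ] linear_cmul[OF linQ] Q incl2_def)
    then show ?thesis ..
  qed
  have P_incl2: "P (incl2 z) \<in> W" for z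
  proof -
    have "P (incl2 z) = z $ 1 *\<^sub>R P (Q u0) + z $ 2 *\<^sub>R P (Q v0)"
      by (simp add: incl2_def Q linear_add[OF linP] linear_cmul[OF linP])
    then show ?thesis unfolding W QP by blast
  qed
  have d0: "d (incl2 z) v = 0" "d v (incl2 z) = 0" for z v
    using central[OF P_incl2] skew[of "P v" "P (incl2 z)"]
    by (simp_all add: d_def linear_0[OF linQ])
  have d_add: "d (a + a') b = d a b + d a' b" "d a (b + b') = d a b + d a b'"
    "d (r *\<^sub>R a) b = r *\<^sub>R d a b" "d a (r *\<^sub>R b) = r *\<^sub>R d a b" for a a' b b' r
    by (simp_all add: d_def linear_add[OF linP] linear_cmul[OF linP] linear_add[OF linQ]
        linear_cmul[OF linQ] blinfun.add_left blinfun.add_right blinfun.scaleR_left blinfun.scaleR_right)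
  have d_skew: "d a b = - d b a" for a b
    using skew[of "P a" "P b"] by (simp add: d_def linear_neg[OF linQ])
  \<comment> \<open>This is the adjoint of \<open>d\<close>, read off from the relation in
    \<open>inner_bracket_of\<close>.\<close>
  define j where "j z = form_matrix (\<lambda>a b. d (incl4 a) (incl4 b) \<bullet> incl2 z)" for z
  have "j z \<in> so4" for z
    unfolding so4_entry
  proof (intro allI)
    fix a b
    show "j z $ b $ a = - (j z $ a $ b)"
      using d_skew[of "incl4 (axis b 1)" "incl4 (axis a 1)"] by (simp add: j_def form_matrix_def)
  qed
  moreover have "linear j"
    by (rule linearI) (simp_all add: j_def form_matrix_def vec_eq_iff linear_add[OF linear_incl2]
        linear_cmul[OF linear_incl2] inner_add_right)
  ultimately have j: "j \<in> Hom_R2_so4" by (auto simp: Hom_R2_so4_def)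
  have "br (bracket_of j) u v = d u v" for u v
  proof -
    have bil: "bilinear (\<lambda>a b. d (incl4 a) (incl4 b) \<bullet> incl2 z)" for z
      by (auto simp: bilinear_def linear_add[OF linear_incl4] linear_cmul[OF linear_incl4] d_add
          inner_add_left intro!: linearI)
    have "d u v = d (incl4 (proj4 u) + incl2 (proj2 u)) (incl4 (proj4 v) + incl2 (proj2 v))"
      using incl4_incl2_split by metis
    also have "\<dots> = d (incl4 (proj4 u)) (incl4 (proj4 v))"
      by (simp add: d_add d0)
    finally have duv: "d u v = d (incl4 (proj4 u)) (incl4 (proj4 v))" .
    have eq: "br (bracket_of j) u v \<bullet> incl2 z = d u v \<bullet> incl2 z" for z
      unfolding inner_bracket_of[OF j] j_def bilinear_form_matrix[OF bil, symmetric] duv ..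
    obtain a b where ab: "br (bracket_of j) u v = incl2 a" "d u v = incl2 b"
      using d_incl2 bracket_of_apply by metis
    have "a \<bullet> z = b \<bullet> z" for z
      using eq[of z] by (simp add: ab inner_6)
    then show ?thesis unfolding ab by (metis vector_eq_rdot)
  qed
  then have "(c, bracket_of j) \<in> O6_rel"
    using Q(1) c bracket_of_in_N6_hat[OF j] dQ by (auto simp: O6_rel_def)
  then have "C = bracket_class (bracket_of j)"
    unfolding C by (simp add: bracket_class_eq_iff c bracket_of_in_N6_hat[OF j])
  moreover obtain w where "j = jpar w" using j Hom_R2_so4_eq_range by blast
  ultimately show "C \<in> range cpar" by (simp add: cpar_def)
qed

text \<open>The determinant of the last two coordinates of the brackets [e1, e2] and
  [e1, e3].\<close>

definition minor :: "params \<Rightarrow> real" where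
  "minor w = (case w of ((x, y), (p, q)) \<Rightarrow>
     (x $ 1 + p $ 1) * (y $ 2 + q $ 2) - (x $ 2 + p $ 2) * (y $ 1 + q $ 1))"

lemma cpar_in_N62:
  assumes "minor w \<noteq> 0" shows "cpar w \<in> N62"
proof -
  obtain x y p q where w: "w = ((x, y), (p, q))" by (metis prod.exhaust)
  define A B C D where "A = x $ 1 + p $ 1" and "B = x $ 2 + p $ 2" and "C = y $ 1 + q $ 1" and "D = y $ 2 + q $ 2"
  have m: "A * D - B * C \<noteq> 0"
    using assms by (simp add: minor_def w A_def B_def C_def D_def)
  define c where "c = bracket_of (jpar w)"
  define V where "V = {axis 5 1, axis 6 1 :: real^6}"
  have "br c (axis 1 1) (axis 2 1) = A *\<^sub>R axis 5 1 + C *\<^sub>R axis 6 1"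
    "br c (axis 1 1) (axis 3 1) = B *\<^sub>R axis 5 1 + D *\<^sub>R axis 6 1"
    unfolding c_def jpar_def w fst_conv snd_conv bracket_of_apply incl2_def proj4_axis
    by (simp_all add: matrix_entry jmap_def A_def B_def C_def D_def) (simp_all add: axis_def)
  then have f: "A *\<^sub>R axis 5 1 + C *\<^sub>R axis 6 1 \<in> commutator_ideal c"
    "B *\<^sub>R axis 5 1 + D *\<^sub>R axis 6 1 \<in> commutator_ideal c"
    unfolding commutator_ideal_def by (metis (mono_tags, lifting) mem_Collect_eq span_base)+
  have sub: "subspace (commutator_ideal c)" by (simp add: commutator_ideal_def)
  \<comment> \<open>Cramer's rule recovers the two axes from the two brackets.\<close>
  have "(A * D - B * C) *\<^sub>R axis 5 1 = D *\<^sub>R (A *\<^sub>R axis 5 1 + C *\<^sub>R axis 6 1) - C *\<^sub>R (B *\<^sub>R axis 5 1 + D *\<^sub>R (axis 6 1 :: real^6))"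
    "(A * D - B * C) *\<^sub>R axis 6 1 = A *\<^sub>R (B *\<^sub>R axis 5 1 + D *\<^sub>R axis 6 1) - B *\<^sub>R (A *\<^sub>R axis 5 1 + C *\<^sub>R (axis 6 1 :: real^6))"
    by (simp_all add: algebra_simps)
  then have "(A * D - B * C) *\<^sub>R axis 5 1 \<in> commutator_ideal c"
    and "(A * D - B * C) *\<^sub>R axis 6 1 \<in> commutator_ideal c"
    using f by (simp_all add: sub subspace_diff subspace_scale)
  from this[THEN subspace_scale[OF sub, of _ "1 / (A * D - B * C)"]]
  have "V \<subseteq> commutator_ideal c" using m by (simp add: V_def)
  then have "span V \<subseteq> commutator_ideal c"
    using sub by (rule span_minimal)
  moreover have "commutator_ideal c \<subseteq> span V"
    unfolding commutator_ideal_def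
  proof (intro span_minimal subspace_span subsetI)
    fix z assume "z \<in> {br c u v | u v. True}"
    then obtain a where "z = incl2 a"
      unfolding c_def bracket_of_apply by blast
    then show "z \<in> span V"
      unfolding V_def incl2_def by (simp add: span_add span_scale span_base)
  qed
  ultimately have "commutator_ideal c = span V" by blast
  moreover have "independent V"
  proof (rule pairwise_orthogonal_independent)
    show "pairwise orthogonal V"
      by (auto simp: V_def pairwise_def orthogonal_def inner_axis_axis)
    show "0 \<notin> V" by (simp add: V_def axis_eq_0_iff)
  qed
  moreover have "card V = 2"
    by (simp add: V_def axis_eq_axis)
  ultimately have "dim (commutator_ideal c) = 2"
    by (simp add: dim_eq_card_independent)
  then show ?thesis
    unfolding N62_def cpar_def c_def[symmetric] using bracket_of_in_N6_hat[OF jpar_in_Hom] c_def by blast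
qed

text \<open>Moving x along the first and y along the second axis by t makes the minor a monic
  quadratic polynomial in t, which cannot vanish for all small positive t.\<close>

lemma closure_minor_ne_0: "closure {w. minor w \<noteq> 0} = UNIV"
proof -
  have "w \<in> closure {w. minor w \<noteq> 0}" for w
    unfolding closure_approachable
  proof (intro allI impI)
    fix e :: real assume e: "0 < e"
    obtain x y p q where w: "w = ((x, y), (p, q))" by (metis prod.exhaust)
    define w' where "w' t = ((x + t *\<^sub>R axis 1 1, y + t *\<^sub>R axis 2 1), (p, q))" for t :: real
    define b c where "b = (x $ 1 + p $ 1) + (y $ 2 + q $ 2)" and "c = minor w"
    have minor: "minor (w' t) = t * t + b * t + c" for t
      by (simp add: minor_def w'_def w b_def c_def axis_def algebra_simps)
    have dist: "dist (w' t) w < e" if "0 < t" "t \<le> e / 4" for t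
    proof -
      have "w' t - w = ((t *\<^sub>R axis 1 1, t *\<^sub>R axis 2 1), (0, 0))"
        by (simp add: w'_def w zero_prod_def)
      then have "dist (w' t) w = norm (t *\<^sub>R axis 1 1 :: real^3, t *\<^sub>R axis 2 1 :: real^3)"
        unfolding dist_norm by (simp add: norm_Pair)
      also have "\<dots> \<le> norm (t *\<^sub>R axis 1 1 :: real^3) + norm (t *\<^sub>R axis 2 1 :: real^3)"
        by (rule norm_Pair_le)
      also have "\<dots> = 2 * t"
        using that by simp
      finally show ?thesis using that by simp
    qed
    have "\<exists>t. 0 < t \<and> t \<le> e / 4 \<and> minor (w' t) \<noteq> 0"
    proof (rule ccontr)
      assume "\<not> ?thesis"
      then have 0: "t * t + b * t + c = 0" if "0 < t" "t \<le> e / 4" for t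
        using that by (auto simp: minor)
      \<comment> \<open>Two distinct zeros add up to -b, so e/4 cannot be a zero together with both
        e/5 and e/6.\<close>
      have "t + s + b = 0" if "0 < t" "t \<le> e / 4" "0 < s" "s \<le> e / 4" "t \<noteq> s" for t s
      proof -
        have "(t - s) * (t + s + b) = (t * t + b * t + c) - (s * s + b * s + c)"
          by (simp add: algebra_simps)
        then have "(t - s) * (t + s + b) = 0" using 0 that by simp
        then show ?thesis using that by simp
      qed
      from this[of "e / 4" "e / 5"] this[of "e / 4" "e / 6"] show False using e by simp
    qed
    then show "\<exists>y\<in>{w. minor w \<noteq> 0}. dist y w < e" using dist by blast
  qed
  then show ?thesis by blast
qed

text \<open>One inclusion holds because the image of the parameter space is closed and contains
  \<open>N62\<close>, the other because parameters with nonzero minor are dense and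
  \<open>cpar\<close> is continuous.\<close>

lemma closure_of_N62: "N6 closure_of N62 = range cpar"
proof
  have "closedin N6 (range cpar)"
    using closed_map_cpar by (simp add: closed_map_def)
  then show "N6 closure_of N62 \<subseteq> range cpar"
    by (intro closure_of_minimal N62_subset_range_cpar)
  have "cpar ` (euclidean closure_of {w. minor w \<noteq> 0}) \<subseteq> N6 closure_of (cpar ` {w. minor w \<noteq> 0})"
    by (rule continuous_map_image_closure_subset[OF continuous_map_cpar])
  also have "\<dots> \<subseteq> N6 closure_of N62"
    by (intro closure_of_mono) (auto intro: cpar_in_N62)
  finally show "range cpar \<subseteq> N6 closure_of N62"
    by (simp add: closure_minor_ne_0)
qed

text \<open>By \<open>cpar_eq_iff\<close> all representatives of a class have the same value, so
  \<open>the_elem\<close> is applied to a singleton.\<close>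

lemma Psi_cpar: "Psi (cpar w) = S_class (ipar w)"
proof -
  have "{S_class (invariants j) | j. j \<in> Hom_R2_so4 \<and> bracket_class (bracket_of j) = cpar w} =
      {S_class (ipar w)}" (is "?L = _")
  proof (intro equalityI subsetI)
    fix s assume "s \<in> ?L"
    then obtain w' where "s = S_class (ipar w')" "cpar w' = cpar w"
      unfolding Hom_R2_so4_eq_range cpar_def invariants_jpar[symmetric] by blast
    then show "s \<in> {S_class (ipar w)}" by (simp add: cpar_eq_iff)
  next
    fix s assume "s \<in> {S_class (ipar w)}"
    then show "s \<in> ?L"
      using jpar_in_Hom unfolding cpar_def invariants_jpar[symmetric] by blast
  qed
  then show ?thesis by (simp add: Psi_def)
qed

theorem theorem4p1:
  shows "N6 closure_of N62 = {bracket_class (bracket_of j) | j. j \<in> Hom_R2_so4} \<and>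
    (\<forall>j\<in>Hom_R2_so4. Psi (bracket_class (bracket_of j)) = S_class (invariants j)) \<and>
    homeomorphic_map (subtopology N6 (N6 closure_of N62)) S_space Psi"
proof (intro conjI ballI)
  show "N6 closure_of N62 = {bracket_class (bracket_of j) | j. j \<in> Hom_R2_so4}"
    unfolding closure_of_N62 Hom_R2_so4_eq_range by (auto simp: cpar_def)
  show "Psi (bracket_class (bracket_of j)) = S_class (invariants j)" if "j \<in> Hom_R2_so4" for j
    using that Psi_cpar unfolding Hom_R2_so4_eq_range by (auto simp: cpar_def invariants_jpar)
  let ?T = "subtopology N6 (range cpar)"
  have top: "topspace ?T = range cpar"
    using continuous_map_cpar by (auto simp: continuous_map_def Pi_iff)
  have "quotient_map euclidean ?T cpar"
  proof (rule continuous_closed_imp_quotient_map)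
    show "continuous_map euclidean ?T cpar"
      using continuous_map_cpar by (simp add: continuous_map_in_subtopology)
    show "closed_map euclidean ?T cpar"
      using closed_map_cpar by (simp add: closed_map_into_subtopology)
    show "cpar ` topspace euclidean = topspace ?T" unfolding top by simp
  qed
  \<comment> \<open>Since \<open>cpar\<close> and \<open>Psi \<circ> cpar\<close> are quotient maps,
    so is \<open>Psi\<close>; an injective quotient map is a homeomorphism.\<close>
  moreover have "quotient_map euclidean S_space (Psi \<circ> cpar)"
    using quotient_map_S_class_ipar by (simp add: o_def Psi_cpar)
  ultimately have "quotient_map ?T S_space Psi"
    by (simp add: quotient_map_compose_eq)
  moreover have "inj_on Psi (topspace ?T)"
    unfolding top
  proof (rule inj_onI)
    fix a b assume "a \<in> range cpar" "b \<in> range cpar" "Psi a = Psi b"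
    moreover from this obtain w w' where "a = cpar w" "b = cpar w'" by blast
    ultimately show "a = b" by (simp add: Psi_cpar cpar_eq_iff)
  qed
  ultimately show "homeomorphic_map (subtopology N6 (N6 closure_of N62)) S_space Psi"
    by (simp add: homeomorphic_map_def closure_of_N62)
qed

end
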